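(* Let $\nabla_0=d+\Omega_0$ be the normal form on $E_0$ of a connection $(E,\nabla)\in\mathcal V$, as described in the context. The local (possibly ramified) formal decomposition $E_0=L^+\oplus L^-$ by $\nabla_0$-invariant subbundles $L^{\pm}$ at each singular point $t_i$ is determined up to order $n_i-1$ by $$J^{n_i-1}\big(L^{\pm}\big)=\begin{pmatrix}1\\ J^{n_i-1}(y)\end{pmatrix}\quad\text{where}\quad y^2=\Big(\prod_{j\neq i}(x-t_j)^{n_j}\Big)\big(C_i(x)+y\,D_i(x)\big)$$ (the two solutions $y$ corresponding to $L^+$ and $L^-$). In particular, it depends only on the formal invariants $\Lambda$, not on accessory parameters.
   Context: Everything is over $\mathbb C$; $x$ is an affine coordinate on $\mathbb P^1$. $D=\sum_{i=1}^{\nu}n_i[t_i]+n_\infty[\infty]$ is an effective divisor of degree $n$ with $n_\infty\ge1$, and $P(x)=\prod_{i=1}^{\nu}(x-t_i)^{n_i}$. Formal data of a rank $2$ connection $\nabla=d+\Omega$ at a pole $t$ of order $m$: $\Lambda_t(\nabla)=(\mathrm{tr}(\nabla)^{<0}_t,\det(\nabla)^{<-m}_t)$, where the first term is the class of $\mathrm{tr}\,\Omega$ in germs of $\Omega^1(D)/\Omega^1$ and the second is the class of $\det\Omega$ in germs of $(\Omega^1(D))^{\otimes 2}/(\Omega^1)^{\otimes2}(D)$. A collection $\Lambda$ of such data at all points of $D$ is fixed, satisfying the Fuchs relation $\sum\mathrm{Res}\,\mathrm{tr}=-1$, with reduced poles (non-scalar leading coefficients, and at poles of order $m>1$ the discriminant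 $\mathrm{tr}^2-4\det$ has pole order $2m$, the unramified case, or $2m-1$, the ramified case). $\mathcal V$ is the set of (isomorphism classes of stable) connections $(E,\nabla)$ with polar divisor $D$, formal data $\Lambda$, $E\simeq\mathcal O\oplus\mathcal O(1)$, $\mathcal O(1)$ not $\nabla$-invariant, such that the zero divisor $Q=q_1+\dots+q_{n-3}$ of the $\mathcal O$-linear map $\varphi_\nabla:\mathcal O(1)\hookrightarrow E\xrightarrow{\nabla}E\otimes\Omega^1(D)\to(E/\mathcal O(1))\otimes\Omega^1(D)\simeq\Omega^1(D)$ is reduced and disjoint from $D$. Applying $\mathrm{id}\oplus\varphi_\nabla:\mathcal O\oplus\mathcal O(1)\dashrightarrow E_0=\mathcal O\oplus\Omega^1(D)$ and an automorphism of $E_0$ (second coordinate relative to the generator $dx/P$), such a connection has a unique normal form $\nabla_0=d+\Omega_0$, $$\Omega_0=\begin{pmatrix}0&\frac1{P}\\ c_0&d_0\end{pmatrix}dx,\quad c_0=\sum_{i=1}^{\nu}\frac{C_i(x)}{(x-t_i)^{n_i}}+\sum_{j=1}^{n-3}\frac{\zeta_j}{x-q_j}+\tilde C(x)+x^{n-3}C_\infty(x),$$ $$d_0=\sum_{i=1}^{\nu}\frac{D_i(x)}{(x-t_i)^{n_i}}-\sum_{j=1}^{n-3}\frac{1}{x-q_j}+D_\infty(x),$$ with $\zeta_j\in\mathbb C$ and polynomials $\deg C_i,\deg D_i\le n_i-1$, $\deg C_\infty\le n_\infty-1$, $\deg D_\infty\le n_\infty-2$, $\deg\tilde C\le n-4$.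 The Hukuhara–Levelt–Turrittin decomposition at a pole is the splitting of the formal completion of the bundle into two $\nabla_0$-invariant formal line subbundles $L^\pm$ (in the ramified case, after the base change $\zeta=\sqrt{x-t_i}$). $J^{k}$ denotes the $k$-jet at $t_i$ (truncation of the power series at order $k$). Accessory parameters are the $(q_j,\zeta_j)$.
   Formalization: At ramified poles, with jets in x−t_i, the formula with exact y fails in its last term (x−t_i)^{n_i−1}; instead L^± has the jet of a Y solving the equation modulo jets and equal to y in all lower terms. Dependence only on Λ is kept for the full jet. *)

theory Defs
  imports "HOL-Complex_Analysis.Complex_Analysis"
begin

datatype proj_line = Affine complex | Infty

type_synonym divisor = "proj_line \<Rightarrow> nat"

definition supp :: "divisor \<Rightarrow> proj_line set" where
  "supp D = {p. D p \<noteq> 0}"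

definition fin_supp :: "divisor \<Rightarrow> complex set" where
  "fin_supp D = {t. D (Affine t) \<noteq> 0}"

definition div_deg :: "divisor \<Rightarrow> nat" where
  "div_deg D = (\<Sum>p\<in>supp D. D p)"

definition div_poly :: "divisor \<Rightarrow> complex poly" where
  "div_poly D = (\<Prod>t\<in>fin_supp D. [:- t, 1:] ^ D (Affine t))"

definition cofactor_poly :: "divisor \<Rightarrow> complex \<Rightarrow> complex poly" where
  "cofactor_poly D t = (\<Prod>s\<in>fin_supp D - {t}. [:- s, 1:] ^ D (Affine s))"

text \<open>
  A connection is given by the matrix \<open>\<Omega>\<close> of \<open>\<nabla> = d + \<Omega> dx\<close> in a frame \<open>(e\<^sub>1, e\<^sub>2)\<close>
  over the affine line, where \<open>e\<^sub>1\<close> generates \<open>\<O>\<close> and \<open>e\<^sub>2\<close> generates \<open>\<O>(1)\<close>; the sections of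
  \<open>\<O>(1)\<close> are the \<open>f e\<^sub>2\<close> with \<open>f\<close> a polynomial of degree at most 1, and \<open>x e\<^sub>2\<close> is a generator
  at infinity. Values at the finitely many bad points are irrelevant, so identities between
  such matrices are required outside a finite set only.
\<close>

definition rational_fun :: "(complex \<Rightarrow> complex) \<Rightarrow> bool" where
  "rational_fun f \<longleftrightarrow>
     (\<exists>a b. b \<noteq> 0 \<and> (\<forall>\<^sub>F x in cofinite. f x = poly a x / poly b x))"

text \<open>The matrix in the coordinate \<open>w = 1/x\<close> and the frame \<open>(e\<^sub>1, x e\<^sub>2)\<close>; note \<open>dx = - dw / w\<^sup>2\<close>.\<close>

definition matrix_at_infty :: "(complex \<Rightarrow> complex^2^2) \<Rightarrow> complex \<Rightarrow> complex^2^2" where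
  "matrix_at_infty \<Omega> w = vector
     [vector [- \<Omega> (1/w) $ 1 $ 1 / w^2, - \<Omega> (1/w) $ 1 $ 2 / w^3],
      vector [- \<Omega> (1/w) $ 2 $ 1 / w,   - \<Omega> (1/w) $ 2 $ 2 / w^2 - 1 / w]]"

fun local_matrix :: "(complex \<Rightarrow> complex^2^2) \<Rightarrow> proj_line \<Rightarrow> complex fls^2^2" where
  "local_matrix \<Omega> (Affine t) = (\<chi> i j. laurent_expansion (\<lambda>x. \<Omega> x $ i $ j) t)"
| "local_matrix \<Omega> Infty = (\<chi> i j. laurent_expansion (\<lambda>w. matrix_at_infty \<Omega> w $ i $ j) 0)"

definition connection :: "divisor \<Rightarrow> (complex \<Rightarrow> complex^2^2) \<Rightarrow> bool" where
  "connection D \<Omega> \<longleftrightarrow>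
     (\<forall>i j. rational_fun (\<lambda>x. \<Omega> x $ i $ j)) \<and>
     (\<forall>p i j. fls_subdegree (local_matrix \<Omega> p $ i $ j) \<ge> - int (D p))"

text \<open>The line subbundles of \<open>\<O> \<oplus> \<O>(1)\<close> are generated over the affine line by \<open>a e\<^sub>1 + b e\<^sub>2\<close> for
  coprime polynomials \<open>a, b\<close>, and the degree is read off at infinity.\<close>

definition sub_degree :: "complex poly \<Rightarrow> complex poly \<Rightarrow> int" where
  "sub_degree a b =
     (if a = 0 then 1 - int (degree b)
      else if b = 0 then - int (degree a)
      else - max (int (degree a)) (int (degree b) - 1))"

definition invariant_sub ::
  "(complex \<Rightarrow> complex^2^2) \<Rightarrow> complex poly \<Rightarrow> complex poly \<Rightarrow> bool" where
  "invariant_sub \<Omega> a b \<longleftrightarrow> (\<forall>\<^sub>F x in cofinite.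
     let s = vector [poly a x, poly b x] :: complex^2;
         ds = vector [poly (pderiv a) x, poly (pderiv b) x] + \<Omega> x *v s
     in s $ 1 * ds $ 2 = s $ 2 * ds $ 1)"

text \<open>Slope stability; the bundle has slope \<open>1/2\<close>.\<close>

definition stable :: "(complex \<Rightarrow> complex^2^2) \<Rightarrow> bool" where
  "stable \<Omega> \<longleftrightarrow> (\<forall>a b. coprime a b \<and> invariant_sub \<Omega> a b \<longrightarrow> real_of_int (sub_degree a b) < 1/2)"

text \<open>The part of a Laurent series of order less than \<open>k\<close>, which represents its class modulo
  the series of order at least \<open>k\<close>.\<close>

definition fls_below :: "int \<Rightarrow> complex fls \<Rightarrow> complex fls" where
  "fls_below k f = f - fls_shift (- k) (fps_to_fls (fls_regpart (fls_shift k f)))"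

type_synonym formal_data = "proj_line \<Rightarrow> complex fls \<times> complex fls"

definition data_at :: "nat \<Rightarrow> complex fls^2^2 \<Rightarrow> complex fls \<times> complex fls" where
  "data_at m A = (fls_below 0 (trace A), fls_below (- int m) (det A))"

text \<open>For pole order \<open>m > 1\<close> the terms of order less than \<open>-m\<close> of the discriminant depend only on
  the classes, hence so does a pole order \<open>2m\<close> or \<open>2m - 1\<close>.\<close>

definition discriminant :: "complex fls \<times> complex fls \<Rightarrow> complex fls" where
  "discriminant l = (fst l)\<^sup>2 - 4 * snd l"

definition ramified :: "divisor \<Rightarrow> formal_data \<Rightarrow> proj_line \<Rightarrow> bool" where
  "ramified D \<Lambda> p \<longleftrightarrow> D p > 1 \<and> fls_subdegree (discriminant (\<Lambda> p)) = - (2 * int (D p) - 1)"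

definition unramified :: "divisor \<Rightarrow> formal_data \<Rightarrow> proj_line \<Rightarrow> bool" where
  "unramified D \<Lambda> p \<longleftrightarrow>
     D p = 1 \<or> (D p > 1 \<and> fls_subdegree (discriminant (\<Lambda> p)) = - (2 * int (D p)))"

definition ram_index :: "divisor \<Rightarrow> formal_data \<Rightarrow> proj_line \<Rightarrow> nat" where
  "ram_index D \<Lambda> p = (if ramified D \<Lambda> p then 2 else 1)"

definition fuchs_relation :: "divisor \<Rightarrow> formal_data \<Rightarrow> bool" where
  "fuchs_relation D \<Lambda> \<longleftrightarrow> (\<Sum>p\<in>supp D. fls_residue (fst (\<Lambda> p))) = - 1"

definition nonscalar_leading :: "nat \<Rightarrow> complex fls^2^2 \<Rightarrow> bool" where
  "nonscalar_leading m A \<longleftrightarrow> \<not> (\<exists>c. (\<chi> i j. fls_nth (A $ i $ j) (- int m)) = mat c)"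

text \<open>The map \<open>\<phi>\<close> from \<open>\<O>(1)\<close> to \<open>\<Omega>\<^sup>1(D)\<close> relative to the generators \<open>e\<^sub>2\<close> and \<open>dx / P\<close>.\<close>

definition phi :: "divisor \<Rightarrow> (complex \<Rightarrow> complex^2^2) \<Rightarrow> complex \<Rightarrow> complex" where
  "phi D \<Omega> x = poly (div_poly D) x * \<Omega> x $ 1 $ 2"

text \<open>The zero divisor of \<open>\<phi>\<close>, a section of a line bundle of degree \<open>n - 3\<close>, is the reduced divisor
  \<open>Q\<close>. As \<open>Q\<close> has \<open>n - 3\<close> affine points, \<open>\<phi>\<close> does not vanish at infinity.\<close>

definition reduced_zeros :: "divisor \<Rightarrow> (complex \<Rightarrow> complex^2^2) \<Rightarrow> complex set \<Rightarrow> bool" where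
  "reduced_zeros D \<Omega> Q \<longleftrightarrow>
     finite Q \<and> card Q + 3 = div_deg D \<and> Q \<inter> fin_supp D = {} \<and>
     (\<exists>\<kappa>. \<kappa> \<noteq> 0 \<and> (\<forall>\<^sub>F x in cofinite. phi D \<Omega> x = \<kappa> * (\<Prod>q\<in>Q. x - q)))"

text \<open>Since the leading coefficients are not scalar, the polar divisor is exactly \<open>D\<close>.\<close>

definition in_V ::
  "divisor \<Rightarrow> formal_data \<Rightarrow> (complex \<Rightarrow> complex^2^2) \<Rightarrow> complex set \<Rightarrow> bool" where
  "in_V D \<Lambda> \<Omega> Q \<longleftrightarrow>
     connection D \<Omega> \<and> stable \<Omega> \<and>
     (\<forall>p\<in>supp D. data_at (D p) (local_matrix \<Omega> p) = \<Lambda> p \<and>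
                 nonscalar_leading (D p) (local_matrix \<Omega> p)) \<and>
     \<not> invariant_sub \<Omega> 0 1 \<and>
     reduced_zeros D \<Omega> Q"

record nf_coeffs =
  coeff_C :: "complex \<Rightarrow> complex poly"
  coeff_D :: "complex \<Rightarrow> complex poly"
  zeta :: "complex \<Rightarrow> complex"
  C_tilde :: "complex poly"
  C_infty :: "complex poly"
  D_infty :: "complex poly"

definition nf_bounds :: "divisor \<Rightarrow> nf_coeffs \<Rightarrow> bool" where
  "nf_bounds D N \<longleftrightarrow>
     (\<forall>t\<in>fin_supp D. degree (coeff_C N t) + 1 \<le> D (Affine t) \<and>
                     degree (coeff_D N t) + 1 \<le> D (Affine t)) \<and>
     degree (C_infty N) + 1 \<le> D Infty \<and>
     (D_infty N = 0 \<or> degree (D_infty N) + 2 \<le> D Infty) \<and>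
     (C_tilde N = 0 \<or> degree (C_tilde N) + 4 \<le> div_deg D)"

definition nf_c :: "divisor \<Rightarrow> complex set \<Rightarrow> nf_coeffs \<Rightarrow> complex \<Rightarrow> complex" where
  "nf_c D Q N x =
     (\<Sum>t\<in>fin_supp D. poly (coeff_C N t) x / (x - t) ^ D (Affine t)) +
     (\<Sum>q\<in>Q. zeta N q / (x - q)) +
     poly (C_tilde N) x + x ^ (div_deg D - 3) * poly (C_infty N) x"

definition nf_d :: "divisor \<Rightarrow> complex set \<Rightarrow> nf_coeffs \<Rightarrow> complex \<Rightarrow> complex" where
  "nf_d D Q N x =
     (\<Sum>t\<in>fin_supp D. poly (coeff_D N t) x / (x - t) ^ D (Affine t)) -
     (\<Sum>q\<in>Q. 1 / (x - q)) + poly (D_infty N) x"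

definition nf_matrix :: "divisor \<Rightarrow> complex set \<Rightarrow> nf_coeffs \<Rightarrow> complex \<Rightarrow> complex^2^2" where
  "nf_matrix D Q N x = vector
     [vector [0, 1 / poly (div_poly D) x],
      vector [nf_c D Q N x, nf_d D Q N x]]"

text \<open>\<open>h\<close> maps \<open>d + \<Omega> dx\<close> to \<open>d + \<Omega>' dx\<close>, that is \<open>h \<circ> \<nabla> = \<nabla>' \<circ> h\<close>.\<close>

definition gauge_related ::
  "(complex \<Rightarrow> complex^2^2) \<Rightarrow> (complex \<Rightarrow> complex^2^2) \<Rightarrow> (complex \<Rightarrow> complex^2^2) \<Rightarrow> bool" where
  "gauge_related h \<Omega> \<Omega>' \<longleftrightarrow>
     (\<forall>\<^sub>F x in cofinite. det (h x) \<noteq> 0 \<and>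
        h x ** \<Omega> x = (\<chi> i j. deriv (\<lambda>z. h z $ i $ j) x) + \<Omega>' x ** h x)"

text \<open>Automorphisms of \<open>E\<^sub>0 = \<O> \<oplus> \<Omega>\<^sup>1(D)\<close>, in the frame \<open>(1, dx / P)\<close>, are lower triangular: the
  off-diagonal entry is a global section of \<open>\<Omega>\<^sup>1(D)\<close>, a polynomial of degree at most \<open>n - 2\<close>.\<close>

definition normal_form_of ::
  "divisor \<Rightarrow> (complex \<Rightarrow> complex^2^2) \<Rightarrow> complex set \<Rightarrow> nf_coeffs \<Rightarrow> bool" where
  "normal_form_of D \<Omega> Q N \<longleftrightarrow>
     nf_bounds D N \<and>
     (\<exists>\<alpha> \<beta> f. \<alpha> \<noteq> 0 \<and> \<beta> \<noteq> 0 \<and> degree f + 2 \<le> div_deg D \<and>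
        gauge_related
          (\<lambda>x. (vector [vector [\<alpha>, 0], vector [poly f x, \<beta>]] :: complex^2^2) **
               (vector [vector [1, 0], vector [0, phi D \<Omega> x]] :: complex^2^2))
          \<Omega> (nf_matrix D Q N))"

text \<open>Near an affine point \<open>t\<close> we use the coordinate \<open>z\<close> with \<open>x = t + z\<^sup>e\<close>, where \<open>e\<close> is the
  ramification index; the matrix below is relative to \<open>dz\<close>.\<close>

definition pullback_matrix ::
  "(complex \<Rightarrow> complex^2^2) \<Rightarrow> complex \<Rightarrow> nat \<Rightarrow> complex fls^2^2" where
  "pullback_matrix \<Omega> t e =
     (\<chi> i j. laurent_expansion (\<lambda>z. of_nat e * z ^ (e - 1) * \<Omega> (t + z ^ e) $ i $ j) 0)"

definition pullback_poly :: "complex \<Rightarrow> nat \<Rightarrow> complex poly \<Rightarrow> complex fps" where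
  "pullback_poly t e p = fps_of_poly (pcompose p ([:t:] + monom 1 e))"

definition vec_to_fls :: "complex fps^2 \<Rightarrow> complex fls^2" where
  "vec_to_fls s = (\<chi> i. fps_to_fls (s $ i))"

definition nabla :: "complex fls^2^2 \<Rightarrow> complex fps^2 \<Rightarrow> complex fls^2" where
  "nabla A s = (\<chi> i. fls_deriv (fps_to_fls (s $ i))) + A *v vec_to_fls s"

definition formal_line :: "complex fps^2 \<Rightarrow> (complex fps^2) set" where
  "formal_line v = range (\<lambda>f. f *s v)"

definition formal_line_subbundle :: "(complex fps^2) set \<Rightarrow> bool" where
  "formal_line_subbundle L \<longleftrightarrow> (\<exists>v. (\<exists>i. fps_nth (v $ i) 0 \<noteq> 0) \<and> L = formal_line v)"

definition formally_invariant :: "complex fls^2^2 \<Rightarrow> (complex fps^2) set \<Rightarrow> bool" where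
  "formally_invariant A L \<longleftrightarrow> (\<forall>s\<in>L. \<exists>r. \<exists>u\<in>L. nabla A s = r *s vec_to_fls u)"

text \<open>In the ramified case the two line subbundles coincide at \<open>z = 0\<close> (the leading coefficient is not
  scalar and has a double eigenvalue), so that they span only over the Laurent series.\<close>

definition formal_decomposition ::
  "nat \<Rightarrow> complex fls^2^2 \<Rightarrow> (complex fps^2) set \<Rightarrow> (complex fps^2) set \<Rightarrow> bool" where
  "formal_decomposition e A Lp Lm \<longleftrightarrow>
     formal_line_subbundle Lp \<and> formally_invariant A Lp \<and>
     formal_line_subbundle Lm \<and> formally_invariant A Lm \<and>
     Lp \<inter> Lm = {0} \<and>
     (e = 1 \<longrightarrow> (\<forall>s. \<exists>u\<in>Lp. \<exists>v\<in>Lm. s = u + v))"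

text \<open>\<open>k\<close>-jets with respect to \<open>x - t = z\<^sup>e\<close>: the terms \<open>z\<^sup>j\<close> with \<open>j \<le> e k\<close> are kept.\<close>

definition jet :: "nat \<Rightarrow> nat \<Rightarrow> complex fps \<Rightarrow> complex fps" where
  "jet e k y = fps_cutoff (e * k + 1) y"

definition line_jet :: "nat \<Rightarrow> nat \<Rightarrow> (complex fps^2) set \<Rightarrow> (complex fps^2) set" where
  "line_jet e k L = (\<lambda>s. \<chi> i. jet e k (s $ i)) ` L"

definition quadratic_rhs ::
  "divisor \<Rightarrow> nf_coeffs \<Rightarrow> complex \<Rightarrow> nat \<Rightarrow> complex fps \<Rightarrow> complex fps" where
  "quadratic_rhs D N t e y =
     pullback_poly t e (cofactor_poly D t) *
     (pullback_poly t e (coeff_C N t) + y * pullback_poly t e (coeff_D N t))"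

end

theory Submission
  imports Defs
begin

text \<open>
  Write \<open>x = t + z\<^sup>e\<close> with \<open>e = a + 1 \<in> {1, 2}\<close>. The line generated by \<open>(1, y)\<close> is invariant under the
  normal form \<open>\<nabla>\<^sub>0\<close> exactly when \<open>y' + e z\<^sup>a (c\<^sub>0 + y d\<^sub>0) = e z\<^sup>a y\<^sup>2 / P\<close>. Let \<open>R\<close> be the cofactor of
  \<open>(x - t)\<^sup>m\<close> in \<open>P\<close>. Clearing the pole turns this into the Riccati equation
  \<open>y\<^sup>2 = R C + y R D + z\<^sup>b (R / e) y' + z\<^bsup>b + a\<^esup> (\<dots>)\<close> with \<open>b = e (m - 1) + 1\<close>, where \<open>C, D\<close> are the
  coefficients of the principal parts at \<open>t\<close>. The derivative and everything
  that the accessory parameters influence only enter from order \<open>b\<close> on, and a jet of order \<open>m - 1\<close> in \<open>x - t\<close> is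
  precisely the truncation of a series in \<open>z\<close> before order \<open>b\<close>. Hence \<open>y\<close> solves the quadratic
  equation \<open>y\<^sup>2 = R C + y R D\<close> modulo \<open>z\<^sup>b\<close>.

  The two roots of the quadratic equation differ to order exactly \<open>a\<close>: in the unramified case the
  discriminant is a unit because the two lines span the fibre at \<open>t\<close>, in the ramified case it has a
  simple zero in \<open>x - t\<close>. A product that vanishes to order \<open>b\<close>, with factors that differ to order
  \<open>a\<close>, has a factor vanishing to order \<open>b - a\<close> (\<open>riccati_near_root\<close>); so \<open>y\<close> agrees with one of the roots
  to that order. For \<open>a = 0\<close> this is the whole jet. For \<open>a = 1\<close> one more coefficient is left open by
  the quadratic equation, and the derivative term does contribute to it. But two solutions of Riccati
  equations with the same \<open>R, C, D\<close> that are close to the same root agree modulo \<open>z\<^sup>b\<close>, whatever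
  the terms of order \<open>b + a\<close> are (\<open>riccati_unique_jet\<close>). The two lines of one decomposition are close
  to different roots (\<open>riccati_separated\<close> when \<open>a = 1\<close>).

  It remains to see that \<open>C\<close> and \<open>D\<close> depend only on the formal data. The gauge transformation from
  \<open>\<nabla>\<close> to \<open>\<nabla>\<^sub>0\<close> is holomorphic and invertible at \<open>t\<close>, so it changes the trace by a holomorphic
  function and the determinant by a pole of order at most \<open>m\<close> (\<open>gauge_trace_det\<close>). The trace of
  \<open>\<Omega>\<^sub>0\<close> is \<open>d\<^sub>0\<close>, its determinant is \<open>- c\<^sub>0 / P\<close>, and their polar parts recover \<open>D\<close> and \<open>C\<close>
  (\<open>formal_data_determines_coefficients\<close>).
\<close>

unbundle no Formal_Power_Series.fps_syntax

section \<open>Orders of vanishing and quadratic equations over power series\<close>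

lemma fps_X_power_dvd_iff:
  fixes f :: "'a::field fps"
  shows "fps_X ^ k dvd f \<longleftrightarrow> (\<forall>i<k. fps_nth f i = 0)"
proof
  assume "fps_X ^ k dvd f"
  then show "\<forall>i<k. fps_nth f i = 0"
    by (auto simp: fps_X_power_mult_nth elim!: dvdE)
next
  assume "\<forall>i<k. fps_nth f i = 0"
  then have "f = fps_X ^ k * fps_shift k f"
    by (auto simp: fps_eq_iff fps_X_power_mult_nth)
  then show "fps_X ^ k dvd f"
    by (rule dvdI)
qed

lemma fps_X_power_dvd_iff_subdegree:
  fixes f :: "'a::field fps"
  assumes "f \<noteq> 0"
  shows "fps_X ^ k dvd f \<longleftrightarrow> k \<le> subdegree f"
  using assms by (simp add: fps_dvd_iff fps_X_power_subdegree)

lemma fps_cutoff_eq_iff_dvd: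
  fixes f g :: "'a::field fps"
  shows "fps_cutoff k f = fps_cutoff k g \<longleftrightarrow> fps_X ^ k dvd f - g"
  by (auto simp: fps_cutoff_eq_fps_cutoff_iff fps_X_power_dvd_iff)

lemma fps_X_power_dvd_deriv:
  fixes f :: "'a::field fps"
  assumes "fps_X ^ Suc k dvd f"
  shows "fps_X ^ k dvd fps_deriv f"
  using assms by (simp add: fps_X_power_dvd_iff del: power_Suc)

text \<open>
  A series of even order is a power of the variable times a unit, and over the complex numbers every
  unit has a square root.\<close>
lemma fps_square_root_exists:
  fixes f :: "complex fps"
  assumes "f \<noteq> 0" "subdegree f = 2 * a"
  obtains s where "s\<^sup>2 = f" "s \<noteq> 0" "subdegree s = a"
proof -
  define u where "u = unit_factor f"
  have u0: "fps_nth u 0 \<noteq> 0"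
    using assms(1) by (simp add: u_def)
  have f: "f = u * fps_X ^ (2 * a)"
    using fps_unit_factor_decompose[of f] assms(2) by (simp add: u_def)
  define v where "v = fps_radical (\<lambda>_. csqrt) 2 u"
  have v: "v\<^sup>2 = u"
    using power_radical[OF u0, of "\<lambda>_. csqrt" 1] by (simp add: v_def numeral_2_eq_2 del: power_Suc)
       (metis One_nat_def Suc_1 power2_csqrt)
  have s: "(v * fps_X ^ a)\<^sup>2 = f"
    by (simp add: f v power_mult_distrib power_mult [symmetric] mult.commute)
  then have "2 * subdegree (v * fps_X ^ a) = 2 * a"
    using assms(2) subdegree_power[of "v * fps_X ^ a" 2] by simp
  with s assms(1) show ?thesis
    by (intro that[of "v * fps_X ^ a"]) auto
qed

text \<open>
  The order of the difference of the roots is what governs how well an approximate solution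
  determines an exact one.\<close>
lemma quadratic_roots:
  fixes G H :: "complex fps"
  assumes "H\<^sup>2 + 4 * G \<noteq> 0" "subdegree (H\<^sup>2 + 4 * G) = 2 * a"
  obtains y1 y2 where "y1 + y2 = H" "y1 * y2 = - G" "y1 \<noteq> y2" "subdegree (y1 - y2) = a"
proof -
  obtain s where s: "s\<^sup>2 = H\<^sup>2 + 4 * G" "s \<noteq> 0" "subdegree s = a"
    using fps_square_root_exists[OF assms] .
  define c :: "complex fps" where "c = fps_const (1/2)"
  have c: "2 * c = 1"
    by (simp add: c_def numeral_fps_const)
  have c4: "4 * (c * c) = 1"
    using c by algebra
  show ?thesis
  proof
    show "c * (H + s) + c * (H - s) = H"
      using c by algebra
    have d: "c * (H + s) - c * (H - s) = s"
      using c by algebra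
    then show "subdegree (c * (H + s) - c * (H - s)) = a" "c * (H + s) \<noteq> c * (H - s)"
      using s by auto
    show "c * (H + s) * (c * (H - s)) = - G"
      using s(1) c4 by algebra
  qed
qed

lemma quadratic_roots_unique:
  fixes y1 y2 G H :: "'a::idom"
  assumes "y1 + y2 = H" "y1 * y2 = - G"
  shows "{y. y\<^sup>2 = G + y * H} = {y1, y2}"
proof -
  have "G = - (y1 * y2)"
    using assms(2) by simp
  then have "y\<^sup>2 - (G + y * H) = (y - y1) * (y - y2)" for y
    by (simp add: assms(1) [symmetric] algebra_simps power2_eq_square)
  then have "y\<^sup>2 = G + y * H \<longleftrightarrow> (y - y1) * (y - y2) = 0" for y
    by (metis eq_iff_diff_eq_0)
  then show ?thesis
    by auto
qed

section \<open>A quadratic equation perturbed by a small derivative\<close>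

text \<open>
  The parameters \<open>g, k\<close> collect the part of the equation that depends on accessory parameters;
  \<open>T, G, H\<close> depend on the principal parts at the pole only.\<close>
definition riccati ::
  "nat \<Rightarrow> nat \<Rightarrow> complex fps \<Rightarrow> complex fps \<Rightarrow> complex fps \<Rightarrow> complex fps \<Rightarrow> complex fps \<Rightarrow> complex fps \<Rightarrow> bool" where
  "riccati a b T G H g k y \<longleftrightarrow>
     y\<^sup>2 = G + y * H + fps_X ^ b * (T * fps_deriv y + fps_X ^ a * (g + k * y))"

text \<open>
  The product of \<open>p = y - y1\<close> and \<open>q = y - y2\<close> vanishes to order \<open>b\<close>, while \<open>q - p\<close> has order \<open>a\<close>.
  If the orders of \<open>p\<close> and \<open>q\<close> differ, the smaller one is \<open>a\<close>, so the larger one is at least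
  \<open>b - a\<close>; if they are equal, both are at most \<open>a\<close>, which \<open>2 * a < b\<close> excludes.\<close>
lemma riccati_near_root:
  assumes "riccati a b T G H g k y"
    and roots: "y1 + y2 = H" "y1 * y2 = - G" "y1 \<noteq> y2" "subdegree (y1 - y2) = a"
    and b: "2 * a < b"
  shows "fps_X ^ (b - a) dvd y - y1 \<or> fps_X ^ (b - a) dvd y - y2"
proof (cases "y = y1 \<or> y = y2")
  case False
  define p q where "p = y - y1" and "q = y - y2"
  have pq: "p \<noteq> 0" "q \<noteq> 0" "subdegree (q - p) = a"
    using False roots by (auto simp: p_def q_def)
  have "p * q = y\<^sup>2 - y * (y1 + y2) + y1 * y2"
    by (simp add: p_def q_def algebra_simps power2_eq_square)
  also have "\<dots> = fps_X ^ b * (T * fps_deriv y + fps_X ^ a * (g + k * y))"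
    using assms(1) roots by (simp add: riccati_def)
  finally have "p * q = fps_X ^ b * (T * fps_deriv y + fps_X ^ a * (g + k * y))" .
  then have "fps_X ^ b dvd p * q"
    by simp
  then have sum: "b \<le> subdegree p + subdegree q"
    using pq by (subst (asm) fps_X_power_dvd_iff_subdegree) auto
  have "b - a \<le> subdegree p \<or> b - a \<le> subdegree q"
  proof (cases "subdegree p" "subdegree q" rule: linorder_cases)
    case less
    then have "subdegree (q - p) = subdegree p"
      using pq subdegree_diff_eq2[of p q] by simp
    with pq sum show ?thesis by auto
  next
    case equal
    have "q \<noteq> p"
      using roots(3) by (auto simp: p_def q_def)
    then have "min (subdegree q) (subdegree p) \<le> subdegree (q - p)"
      by (rule subdegree_diff_ge)
    with pq sum equal b show ?thesis by simp
  next
    case greater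
    then have "subdegree (q - p) = subdegree q"
      using pq subdegree_diff_eq1[of q p] by simp
    with pq sum show ?thesis by auto
  qed
  with pq show ?thesis
    by (auto simp: fps_X_power_dvd_iff_subdegree p_def q_def)
qed auto

text \<open>
  Modulo \<open>z\<^bsup>b - a\<^esup>\<close>, where \<open>b - a\<close> exceeds \<open>a\<close>, the series \<open>y + w - (y1 + y2)\<close> is \<open>y1 - y2\<close>.\<close>
lemma subdegree_sum_near_root:
  fixes y1 y2 :: "complex fps"
  assumes "fps_X ^ (b - a) dvd y - y1" "fps_X ^ (b - a) dvd w - y1"
    and "y1 \<noteq> y2" "subdegree (y1 - y2) = a" "2 * a < b"
  shows "y + w - (y1 + y2) \<noteq> 0" "subdegree (y + w - (y1 + y2)) = a"
proof -
  have "fps_X ^ (b - a) dvd (y - y1) + (w - y1)"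
    using assms by (intro dvd_add)
  then have z: "fps_nth ((y - y1) + (w - y1)) i = 0" if "i \<le> a" for i
    using that assms(5) by (auto simp: fps_X_power_dvd_iff)
  have nth: "fps_nth (y + w - (y1 + y2)) i = fps_nth (y1 - y2) i" if "i \<le> a" for i
  proof -
    have "y + w - (y1 + y2) = ((y - y1) + (w - y1)) + (y1 - y2)"
      by simp
    then show ?thesis
      using z[OF that] by (metis add_0 fps_add_nth)
  qed
  have "fps_nth (y1 - y2) a \<noteq> 0"
    using assms(3,4) nth_subdegree_nonzero[of "y1 - y2"] by simp
  then have na: "fps_nth (y + w - (y1 + y2)) a \<noteq> 0"
    using nth[of a] by simp
  then show "y + w - (y1 + y2) \<noteq> 0"
    by (metis fps_zero_nth)
  show "subdegree (y + w - (y1 + y2)) = a"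
    using na nth assms(4) by (intro subdegreeI) auto
qed

text \<open>
  Subtract the two equations: \<open>\<delta> = y - w\<close> satisfies
  \<open>\<delta> (y + w - H) = z\<^sup>b (T \<delta>' + z\<^sup>a (\<dots>))\<close>. The factor next to \<open>\<delta>\<close> has order \<open>a\<close>, and \<open>\<delta>'\<close> already
  vanishes to order \<open>b - a - 1 \<ge> a\<close>, so the right-hand side vanishes to order \<open>b + a\<close>. The unknown terms
  \<open>g, k\<close> may differ between the two equations.\<close>
lemma riccati_unique_jet:
  assumes "riccati a b T G H g k y" "riccati a b T G H g' k' w"
    and roots: "y1 + y2 = H" "y1 \<noteq> y2" "subdegree (y1 - y2) = a"
    and b: "2 * a < b"
    and near: "fps_X ^ (b - a) dvd y - y1" "fps_X ^ (b - a) dvd w - y1"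
  shows "fps_X ^ b dvd y - w"
proof (cases "y = w")
  case False
  define \<delta> where "\<delta> = y - w"
  define u where "u = y + w - H"
  have u: "u \<noteq> 0" "subdegree u = a"
    using subdegree_sum_near_root[OF near roots(2,3) b] roots(1) by (auto simp: u_def)
  have \<delta>0: "\<delta> \<noteq> 0"
    using False by (simp add: \<delta>_def)
  have "fps_X ^ (b - a) dvd (y - y1) - (w - y1)"
    using near by (rule dvd_diff)
  then have "fps_X ^ Suc a dvd \<delta>"
    using b by (simp add: \<delta>_def fps_X_power_dvd_iff del: power_Suc)
  then have "fps_X ^ a dvd fps_deriv \<delta>"
    by (rule fps_X_power_dvd_deriv)
  then have "fps_X ^ b * fps_X ^ a dvd
      fps_X ^ b * (T * fps_deriv \<delta> + fps_X ^ a * ((g + k * y) - (g' + k' * w)))"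
    by (intro mult_dvd_mono dvd_add) auto
  moreover have "\<delta> * u = fps_X ^ b * (T * fps_deriv \<delta> + fps_X ^ a * ((g + k * y) - (g' + k' * w)))"
  proof -
    have "\<delta> * u = (y\<^sup>2 - y * H) - (w\<^sup>2 - w * H)"
      by (simp add: \<delta>_def u_def algebra_simps power2_eq_square)
    also have "\<dots> = (G + fps_X ^ b * (T * fps_deriv y + fps_X ^ a * (g + k * y)))
        - (G + fps_X ^ b * (T * fps_deriv w + fps_X ^ a * (g' + k' * w)))"
      using assms(1,2) by (simp add: riccati_def)
    finally show ?thesis
      by (simp add: \<delta>_def algebra_simps)
  qed
  ultimately have "fps_X ^ (b + a) dvd \<delta> * u"
    by (simp add: power_add)
  then have "b + a \<le> subdegree \<delta> + a"
    using u \<delta>0 by (subst (asm) fps_X_power_dvd_iff_subdegree) auto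
  then show ?thesis
    using \<delta>0 by (simp add: fps_X_power_dvd_iff_subdegree flip: \<delta>_def)
qed auto

text \<open>
  For two solutions of the same equation the right-hand side of the equation for \<open>\<delta> = y - w\<close> has a
  factor \<open>\<delta>\<close> or \<open>\<delta>'\<close> throughout, hence order at least \<open>b - 1\<close> more than \<open>\<delta>\<close>. If both were close to
  the same root, the left-hand side would have order exactly \<open>a\<close> more, and \<open>a < b - 1\<close>. For
  \<open>a = 0, b = 1\<close> the conclusion can fail: there the exponents may differ by an integer.\<close>
lemma riccati_separated:
  assumes "riccati a b T G H g k y" "riccati a b T G H g k w" "y \<noteq> w"
    and roots: "y1 + y2 = H" "y1 \<noteq> y2" "subdegree (y1 - y2) = a"
    and b: "2 * a < b" and "0 < a"
    and near: "fps_X ^ (b - a) dvd y - y1"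
  shows "\<not> fps_X ^ (b - a) dvd w - y1"
proof
  assume near': "fps_X ^ (b - a) dvd w - y1"
  define \<delta> where "\<delta> = y - w"
  define u where "u = y + w - H"
  have u: "u \<noteq> 0" "subdegree u = a"
    using subdegree_sum_near_root[OF near near' roots(2,3) b] roots(1) by (auto simp: u_def)
  have \<delta>0: "\<delta> \<noteq> 0"
    using \<open>y \<noteq> w\<close> by (simp add: \<delta>_def)
  define n where "n = subdegree \<delta> - 1"
  have "fps_X ^ n dvd \<delta>"
    using \<delta>0 by (simp add: fps_X_power_dvd_iff_subdegree n_def)
  have "fps_X ^ n dvd fps_deriv \<delta>"
  proof (cases n)
    case (Suc l)
    then have "fps_X ^ Suc n dvd \<delta>"
      using \<delta>0 by (simp add: fps_X_power_dvd_iff_subdegree n_def del: power_Suc)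
    then show ?thesis
      by (rule fps_X_power_dvd_deriv)
  qed simp
  with \<open>fps_X ^ n dvd \<delta>\<close> have "fps_X ^ b * fps_X ^ n dvd
      fps_X ^ b * (T * fps_deriv \<delta> + fps_X ^ a * (k * \<delta>))"
    by (intro mult_dvd_mono dvd_add) auto
  moreover have "\<delta> * u = fps_X ^ b * (T * fps_deriv \<delta> + fps_X ^ a * (k * \<delta>))"
  proof -
    have "\<delta> * u = (y\<^sup>2 - y * H) - (w\<^sup>2 - w * H)"
      by (simp add: \<delta>_def u_def algebra_simps power2_eq_square)
    also have "\<dots> = (G + fps_X ^ b * (T * fps_deriv y + fps_X ^ a * (g + k * y)))
        - (G + fps_X ^ b * (T * fps_deriv w + fps_X ^ a * (g + k * w)))"
      using assms(1,2) by (simp add: riccati_def)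
    finally show ?thesis
      by (simp add: \<delta>_def algebra_simps)
  qed
  ultimately have "fps_X ^ (b + n) dvd \<delta> * u"
    by (simp add: power_add)
  then have "b + n \<le> subdegree \<delta> + a"
    using u \<delta>0 by (subst (asm) fps_X_power_dvd_iff_subdegree) auto
  with b \<open>0 < a\<close> show False
    by (simp add: n_def)
qed

section \<open>Invariant formal lines\<close>


lemma formal_line_generator:
  fixes v :: "complex fps^2"
  assumes "fps_nth (v $ 1) 0 \<noteq> 0"
  shows "formal_line v = formal_line (vector [1, v $ 2 * inverse (v $ 1)])"
proof -
  define w :: "complex fps^2" where "w = vector [1, v $ 2 * inverse (v $ 1)]"
  have inv: "inverse (v $ 1) * v $ 1 = 1"
    using assms by (rule inverse_mult_eq_1)
  have v: "v = v $ 1 *s w"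
    using inv by (simp add: w_def vec_eq_iff forall_2 mult.left_commute mult.commute)
  have w: "w = inverse (v $ 1) *s v"
    using inv by (simp add: w_def vec_eq_iff forall_2 mult.commute)
  have "f *s v = (f * v $ 1) *s w" "f *s w = (f * inverse (v $ 1)) *s v" for f
    by (subst v, simp) (subst w, simp)
  then show ?thesis
    unfolding formal_line_def w_def [symmetric] by (metis (no_types, lifting) equalityI image_subsetI rangeI)
qed

lemma invariant_section:
  assumes "formally_invariant A (formal_line v)" "s \<in> formal_line v"
  shows "fps_to_fls (s $ 1) * nabla A s $ 2 = fps_to_fls (s $ 2) * nabla A s $ 1"
proof -
  obtain r u where ru: "u \<in> formal_line v" "nabla A s = r *s vec_to_fls u"
    using assms unfolding formally_invariant_def by blast
  obtain f g where "s = f *s v" "u = g *s v"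
    using ru(1) assms(2) by (auto simp: formal_line_def)
  then show ?thesis
    unfolding ru(2) by (simp add: vec_to_fls_def fls_times_fps_to_fls mult_ac)
qed

text \<open>
  The first component of a generator cannot vanish at \<open>z = 0\<close>: as the upper right entry has a pole
  and the upper left one is zero, the vector \<open>(0, 1)\<close> is not an eigenvector of the leading
  coefficient. So the line is generated by a vector \<open>(1, y)\<close>, and the Riccati equation says that its
  derivative is proportional to it.\<close>
lemma invariant_line_riccati:
  fixes A :: "complex fls^2^2"
  assumes A: "A $ 1 $ 1 = 0"
      "fps_to_fls (fps_X ^ b * T) * A $ 1 $ 2 = 1"
      "fps_to_fls (fps_X ^ b * T) * A $ 2 $ 1 = fps_to_fls (G + fps_X ^ (b + a) * g)"
      "fps_to_fls (fps_X ^ b * T) * A $ 2 $ 2 = fps_to_fls (H + fps_X ^ (b + a) * k)"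
    and "0 < b"
    and L: "formal_line_subbundle L" "formally_invariant A L"
  obtains y where "L = formal_line (vector [1, y])" "riccati a b T G H g k y"
proof -
  obtain v :: "complex fps^2" and i where v: "fps_nth (v $ i) 0 \<noteq> 0" "L = formal_line v"
    using L(1) by (auto simp: formal_line_subbundle_def)
  define B where "B = fps_X ^ b * T"
  \<comment> \<open>Proportionality of a section to its derivative, as a vanishing determinant, with poles cleared.\<close>
  have cross: "s $ 1 * (B * fps_deriv (s $ 2) + (G + fps_X ^ (b + a) * g) * s $ 1
        + (H + fps_X ^ (b + a) * k) * s $ 2) = s $ 2 * (B * fps_deriv (s $ 1) + s $ 2)"
    if "s \<in> L" for s :: "complex fps^2"
  proof -
    have "fps_to_fls (s $ 1) * nabla A s $ 2 = fps_to_fls (s $ 2) * nabla A s $ 1"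
      using invariant_section[of A v s] L that v(2) by simp
    then have "fps_to_fls (s $ 1) * (fps_to_fls (fps_deriv (s $ 2))
          + A $ 2 $ 1 * fps_to_fls (s $ 1) + A $ 2 $ 2 * fps_to_fls (s $ 2))
        = fps_to_fls (s $ 2) * (fps_to_fls (fps_deriv (s $ 1)) + A $ 1 $ 2 * fps_to_fls (s $ 2))"
      using A(1) by (simp add: nabla_def vec_to_fls_def matrix_vector_mult_def sum_2
          fls_deriv_fps_to_fls add.assoc)
    then have "fps_to_fls (s $ 1) * (fps_to_fls B * fps_to_fls (fps_deriv (s $ 2))
          + fps_to_fls (G + fps_X ^ (b + a) * g) * fps_to_fls (s $ 1)
          + fps_to_fls (H + fps_X ^ (b + a) * k) * fps_to_fls (s $ 2))
        = fps_to_fls (s $ 2) * (fps_to_fls B * fps_to_fls (fps_deriv (s $ 1)) + fps_to_fls (s $ 2))"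
      using A(2-4) unfolding B_def[symmetric] by algebra
    then show ?thesis
      by (simp only: fls_times_fps_to_fls[symmetric] fps_to_fls_plus[symmetric] fps_to_fls_eq_iff)
  qed
  have v1: "fps_nth (v $ 1) 0 \<noteq> 0"
  proof
    assume v0: "fps_nth (v $ 1) 0 = 0"
    have "v \<in> L"
      unfolding v(2) formal_line_def by (rule range_eqI[of _ _ 1]) simp
    from arg_cong[OF cross[OF this], of "\<lambda>f. fps_nth f 0"] have "fps_nth (v $ 2) 0 = 0"
      using v0 \<open>0 < b\<close> by (simp add: B_def)
    with v0 v(1) show False
      using exhaust_2[of i] by auto
  qed
  define y where "y = v $ 2 * inverse (v $ 1)"
  have L_eq: "L = formal_line (vector [1, y])"
    unfolding v(2) y_def by (rule formal_line_generator[OF v1])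
  have "vector [1, y] \<in> L"
    unfolding L_eq formal_line_def by (rule range_eqI[of _ _ 1]) simp
  from cross[OF this] have "riccati a b T G H g k y"
    by (simp add: riccati_def B_def power_add power2_eq_square algebra_simps)
  with L_eq show ?thesis
    by (rule that)
qed

lemma line_jet_cong:
  assumes "jet e n y = jet e n w"
  shows "line_jet e n (formal_line (vector [1, y])) = line_jet e n (formal_line (vector [1, w]))"
proof -
  have "jet e n (f * y) = jet e n (f * w)" for f
    using assms unfolding jet_def fps_cutoff_eq_iff_dvd
    by (metis dvd_mult right_diff_distrib)
  then have "(\<chi> i. jet e n ((f *s vector [1, y]) $ i)) = ((\<chi> i. jet e n ((f *s vector [1, w]) $ i)) :: complex fps^2)" for f
    unfolding vec_eq_iff forall_2 by simp
  then show ?thesis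
    unfolding line_jet_def formal_line_def image_image by simp
qed

section \<open>Local expansion of the normal form\<close>

lemma has_fps_expansion_pullback_poly:
  "(\<lambda>z. poly p (t + z ^ e)) has_fps_expansion pullback_poly t e p"
  by (auto simp: has_fps_expansion_def pullback_poly_def poly_pcompose poly_monom)

lemma pullback_poly_mult: "pullback_poly t e (p * q) = pullback_poly t e p * pullback_poly t e q"
  by (simp add: pullback_poly_def pcompose_mult fps_of_poly_mult)

lemma pullback_poly_add: "pullback_poly t e (p + q) = pullback_poly t e p + pullback_poly t e q"
  by (simp add: pullback_poly_def pcompose_add fps_of_poly_add)

lemma pullback_poly_linear_power: "pullback_poly t e ([:- t, 1:] ^ n) = fps_X ^ (e * n)"
proof -
  have "pcompose [:- t, 1:] ([:t:] + monom 1 e) = monom 1 e"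
    by (simp add: pcompose_pCons)
  then have "pullback_poly t e [:- t, 1:] = fps_X ^ e"
    by (simp add: pullback_poly_def fps_of_poly_monom')
  then show ?thesis
    by (induction n)
       (simp_all add: power_add pullback_poly_def fps_of_poly_monom' pcompose_1 pcompose_mult
          fps_of_poly_mult del: mult_pCons_left)
qed

lemma pullback_poly_nth_0: "0 < e \<Longrightarrow> fps_nth (pullback_poly t e p) 0 = poly p t"
  by (simp add: pullback_poly_def poly_pcompose poly_monom power_0_left flip: poly_0_coeff_0)

lemma pullback_poly_1_nth_ge: "degree p < m \<Longrightarrow> m \<le> j \<Longrightarrow> fps_nth (pullback_poly t 1 p) j = 0"
  by (auto simp: pullback_poly_def monom_altdef intro!: coeff_eq_0 le_less_trans[OF degree_pcompose_le])

lemma pullback_poly_1_inject: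
  assumes "pullback_poly t 1 p = pullback_poly t 1 q"
  shows "p = q"
proof -
  have "pcompose (p - q) ([:t:] + monom 1 1) = 0"
    using assms by (simp add: pullback_poly_def fps_of_poly_eq_iff pcompose_diff)
  then show ?thesis
    by (simp add: pcompose_eq_0_iff monom_altdef)
qed

lemma pullback_poly_1_cong_inject:
  assumes "fps_cutoff m (pullback_poly t 1 p) = fps_cutoff m (pullback_poly t 1 q)"
    and "degree p < m" "degree q < m"
  shows "p = q"
proof (rule pullback_poly_1_inject)
  show "pullback_poly t 1 p = pullback_poly t 1 q"
  proof (rule fps_ext)
    fix j
    show "fps_nth (pullback_poly t 1 p) j = fps_nth (pullback_poly t 1 q) j"
      using assms pullback_poly_1_nth_ge[of p m j t] pullback_poly_1_nth_ge[of q m j t]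
      by (cases "j < m") (auto simp: fps_cutoff_eq_fps_cutoff_iff)
  qed
qed

text \<open>
  The factor \<open>x - t\<close> of \<open>p\<close> is pulled back to \<open>z\<^sup>e\<close>, and the other factor is a unit at \<open>t\<close>.\<close>
lemma subdegree_pullback_simple_zero:
  assumes "fps_nth (pullback_poly t 1 p) 0 = 0" "fps_nth (pullback_poly t 1 p) 1 \<noteq> 0" "0 < e"
  shows "pullback_poly t e p \<noteq> 0" "subdegree (pullback_poly t e p) = e"
proof -
  have "poly p t = 0"
    using assms(1) by (simp add: pullback_poly_nth_0)
  then obtain q where p: "p = [:- t, 1:] * q"
    by (auto simp: poly_eq_0_iff_dvd)
  have pull: "pullback_poly t e' p = fps_X ^ e' * pullback_poly t e' q" for e'
    using pullback_poly_linear_power[of t e' 1] by (simp add: p pullback_poly_mult del: mult_pCons_left)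
  have "poly q t \<noteq> 0"
    using assms(2) pull[of 1] by (simp add: pullback_poly_nth_0)
  then have "fps_nth (pullback_poly t e q) 0 \<noteq> 0"
    using \<open>0 < e\<close> by (simp add: pullback_poly_nth_0)
  then show "pullback_poly t e p \<noteq> 0" "subdegree (pullback_poly t e p) = e"
    unfolding pull by (auto simp: subdegree_mult' fps_X_power_subdegree)
qed

lemma finite_fin_supp: "finite (supp D) \<Longrightarrow> finite (fin_supp D)"
  by (rule finite_imageD[of Affine], erule finite_subset[rotated])
     (auto simp: supp_def fin_supp_def inj_on_def)

lemma div_poly_split:
  assumes "finite (supp D)" "t \<in> fin_supp D"
  shows "div_poly D = [:- t, 1:] ^ D (Affine t) * cofactor_poly D t"
  using prod.remove[OF finite_fin_supp[OF assms(1)] assms(2)]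
  by (simp add: div_poly_def cofactor_poly_def)

lemma cofactor_poly_nonzero:
  assumes "finite (supp D)"
  shows "poly (cofactor_poly D t) t \<noteq> 0"
  using finite_fin_supp[OF assms] by (auto simp: cofactor_poly_def poly_prod poly_power)

lemma poly_analytic_on: "poly p analytic_on (S :: complex set)"
proof -
  have "poly p holomorphic_on UNIV"
    by (auto simp: holomorphic_on_open intro: poly_DERIV)
  then show ?thesis
    by (metis analytic_on_open analytic_on_subset open_UNIV top_greatest)
qed

lemma nf_c_split:
  assumes "finite (supp D)" "t \<in> fin_supp D" "Q \<inter> fin_supp D = {}"
  obtains g where "g analytic_on {t}"
    "\<And>x. nf_c D Q N x = poly (coeff_C N t) x / (x - t) ^ D (Affine t) + g x"
proof
  let ?g = "\<lambda>x. (\<Sum>s\<in>fin_supp D - {t}. poly (coeff_C N s) x / (x - s) ^ D (Affine s)) +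
     (\<Sum>q\<in>Q. zeta N q / (x - q)) +
     poly (C_tilde N) x + x ^ (div_deg D - 3) * poly (C_infty N) x"
  show "?g analytic_on {t}"
    using assms(2,3) by (auto intro!: analytic_intros poly_analytic_on)
  show "nf_c D Q N x = poly (coeff_C N t) x / (x - t) ^ D (Affine t) + ?g x" for x
    using sum.remove[OF finite_fin_supp[OF assms(1)] assms(2)]
    by (simp add: nf_c_def)
qed

lemma nf_d_split:
  assumes "finite (supp D)" "t \<in> fin_supp D" "Q \<inter> fin_supp D = {}"
  obtains g where "g analytic_on {t}"
    "\<And>x. nf_d D Q N x = poly (coeff_D N t) x / (x - t) ^ D (Affine t) + g x"
proof
  let ?g = "\<lambda>x. (\<Sum>s\<in>fin_supp D - {t}. poly (coeff_D N s) x / (x - s) ^ D (Affine s)) -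
     (\<Sum>q\<in>Q. 1 / (x - q)) + poly (D_infty N) x"
  show "?g analytic_on {t}"
    using assms(2,3) by (auto intro!: analytic_intros poly_analytic_on)
  show "nf_d D Q N x = poly (coeff_D N t) x / (x - t) ^ D (Affine t) + ?g x" for x
    using sum.remove[OF finite_fin_supp[OF assms(1)] assms(2)]
    by (simp add: nf_d_def)
qed

lemma analytic_pullback_expansion:
  assumes "g analytic_on {t}" "0 < e"
  obtains G where "(\<lambda>z. g (t + z ^ e)) has_fps_expansion G"
proof -
  have "(g \<circ> (\<lambda>z. t + z ^ e)) analytic_on {0}"
    by (rule analytic_on_compose_gen[OF _ assms(1)]) (use assms(2) in \<open>auto intro!: analytic_intros simp: power_0_left\<close>)
  then show ?thesis
    using that analytic_at_imp_has_fps_expansion_0 by (auto simp: o_def)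
qed

lemma principal_part_expansion:
  assumes "(\<lambda>z. g (t + z ^ e)) has_fps_expansion G"
    "\<And>x. f x = poly p x / (x - t) ^ m + g x"
  shows "(\<lambda>z. f (t + z ^ e)) has_laurent_expansion
           fps_to_fls (pullback_poly t e p) / fls_X ^ (e * m) + fps_to_fls G"
proof -
  have "(\<lambda>z. poly p (t + z ^ e) / z ^ (e * m) + g (t + z ^ e)) has_laurent_expansion
          fps_to_fls (pullback_poly t e p) / fls_X ^ (e * m) + fps_to_fls G"
    by (intro laurent_expansion_intros has_laurent_expansion_fps has_fps_expansion_pullback_poly assms(1))
  then show ?thesis
    by (simp add: assms(2) power_mult)
qed

lemma fps_to_fls_X_power: "fps_to_fls (fps_X ^ n) = fls_X ^ n"
  by (simp add: fps_to_fls_power)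

text \<open>
  The entries have the shape required by \<open>invariant_line_riccati\<close>: multiplied by
  \<open>z\<^sup>b R / e\<close>, which is the inverse of the upper right entry, they become power series that are known
  up to order \<open>b + a\<close>.\<close>
lemma pullback_nf_matrix:
  fixes N :: nf_coeffs
  assumes D: "finite (supp D)" "t \<in> fin_supp D" "Q \<inter> fin_supp D = {}"
    and b: "b + a = Suc a * D (Affine t)"
  defines "(A :: complex fls^2^2) \<equiv> pullback_matrix (nf_matrix D Q N) t (Suc a)"
    and "R \<equiv> pullback_poly t (Suc a) (cofactor_poly D t)"
  defines "B \<equiv> fps_to_fls (fps_X ^ b * (fps_const (1 / of_nat (Suc a)) * R))"
  obtains g k where "A $ 1 $ 1 = 0" "B * A $ 1 $ 2 = 1"
    "B * A $ 2 $ 1 = fps_to_fls (R * pullback_poly t (Suc a) (coeff_C N t) + fps_X ^ (b + a) * g)"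
    "B * A $ 2 $ 2 = fps_to_fls (R * pullback_poly t (Suc a) (coeff_D N t) + fps_X ^ (b + a) * k)"
proof -
  let ?e = "Suc a" and ?m = "D (Affine t)"
  define E :: "complex fls" where "E = fls_const (of_nat ?e) * fls_X ^ a"
  have E: "(\<lambda>z. of_nat ?e * z ^ a) has_laurent_expansion E"
    unfolding E_def by (intro laurent_expansion_intros)
  obtain gc where gc: "gc analytic_on {t}"
    "\<And>x. nf_c D Q N x = poly (coeff_C N t) x / (x - t) ^ ?m + gc x"
    using nf_c_split[OF D, where N = N] by blast
  obtain gd where gd: "gd analytic_on {t}"
    "\<And>x. nf_d D Q N x = poly (coeff_D N t) x / (x - t) ^ ?m + gd x"
    using nf_d_split[OF D, where N = N] by blast
  obtain g where g: "(\<lambda>z. gc (t + z ^ ?e)) has_fps_expansion g"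
    using analytic_pullback_expansion[OF gc(1)] by blast
  obtain k where k: "(\<lambda>z. gd (t + z ^ ?e)) has_fps_expansion k"
    using analytic_pullback_expansion[OF gd(1)] by blast
  have "fps_nth R 0 \<noteq> 0"
    using cofactor_poly_nonzero[OF D(1)] by (simp add: R_def pullback_poly_nth_0)
  then have R0: "R \<noteq> 0" by auto
  have P: "pullback_poly t ?e (div_poly D) = fps_X ^ (b + a) * R"
    by (simp only: div_poly_split[OF D(1,2)] pullback_poly_mult pullback_poly_linear_power R_def b)
  have A11: "A $ 1 $ 1 = 0"
    unfolding A_def pullback_matrix_def nf_matrix_def by (simp add: laurent_expansion_0_eqI)
  have "(\<lambda>z. of_nat ?e * z ^ a * (1 / poly (div_poly D) (t + z ^ ?e))) has_laurent_expansion
      E * (1 / fps_to_fls (fps_X ^ (b + a) * R))"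
    unfolding P [symmetric]
    by (intro laurent_expansion_intros E has_laurent_expansion_fps has_fps_expansion_pullback_poly)
  from laurent_expansion_0_eqI[OF this]
  have A12: "A $ 1 $ 2 = E * (1 / fps_to_fls (fps_X ^ (b + a) * R))"
    by (simp add: A_def pullback_matrix_def nf_matrix_def)
  have "(\<lambda>z. of_nat ?e * z ^ a * nf_c D Q N (t + z ^ ?e)) has_laurent_expansion
      E * (fps_to_fls (pullback_poly t ?e (coeff_C N t)) / fls_X ^ (?e * ?m) + fps_to_fls g)"
    by (intro laurent_expansion_intros E principal_part_expansion[OF g gc(2)])
  from laurent_expansion_0_eqI[OF this]
  have A21: "A $ 2 $ 1 = E * (fps_to_fls (pullback_poly t ?e (coeff_C N t)) / fls_X ^ (b + a) + fps_to_fls g)"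
    unfolding b by (simp add: A_def pullback_matrix_def nf_matrix_def)
  have "(\<lambda>z. of_nat ?e * z ^ a * nf_d D Q N (t + z ^ ?e)) has_laurent_expansion
      E * (fps_to_fls (pullback_poly t ?e (coeff_D N t)) / fls_X ^ (?e * ?m) + fps_to_fls k)"
    by (intro laurent_expansion_intros E principal_part_expansion[OF k gd(2)])
  from laurent_expansion_0_eqI[OF this]
  have A22: "A $ 2 $ 2 = E * (fps_to_fls (pullback_poly t ?e (coeff_D N t)) / fls_X ^ (b + a) + fps_to_fls k)"
    unfolding b by (simp add: A_def pullback_matrix_def nf_matrix_def)
  have "fps_const (1 / of_nat ?e) * fps_const (of_nat ?e) = (1 :: complex fps)"
    by (simp del: of_nat_Suc)
  then have "fps_to_fls (fps_const (1 / of_nat ?e)) * fls_const (of_nat ?e :: complex) = 1"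
    by (metis fls_times_fps_to_fls fps_const_to_fls fps_one_to_fls)
  \<comment> \<open>The factor \<open>E\<close> comes from \<open>dx = e z\<^sup>a dz\<close>; it cancels all of \<open>B\<close> except \<open>R\<close> and the pole.\<close>
  then have BE: "B * E = fls_X ^ (b + a) * fps_to_fls R"
    unfolding B_def E_def by (simp add: fls_times_fps_to_fls fps_to_fls_X_power power_add mult_ac)
  have clear: "X * r * (c / X + h) = r * c + X * (r * h)" if "X \<noteq> 0" for X r c h :: "complex fls"
    using that by (simp add: field_simps)
  show ?thesis
  proof (rule that[OF A11])
    show "B * A $ 1 $ 2 = 1"
      using R0 unfolding A12 mult.assoc [symmetric] BE
      by (simp add: fls_times_fps_to_fls fps_to_fls_X_power)
    show "B * A $ 2 $ 1 = fps_to_fls (R * pullback_poly t ?e (coeff_C N t) + fps_X ^ (b + a) * (R * g))"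
      unfolding A21 mult.assoc [symmetric] BE clear[OF fls_X_pow_nonzero]
      by (simp only: fps_to_fls_plus fls_times_fps_to_fls fps_to_fls_X_power)
    show "B * A $ 2 $ 2 = fps_to_fls (R * pullback_poly t ?e (coeff_D N t) + fps_X ^ (b + a) * (R * k))"
      unfolding A22 mult.assoc [symmetric] BE clear[OF fls_X_pow_nonzero]
      by (simp only: fps_to_fls_plus fls_times_fps_to_fls fps_to_fls_X_power)
  qed
qed

section \<open>Formal data read off from the normal form\<close>

lemma eventually_at_of_cofinite:
  fixes t :: complex
  assumes "eventually P cofinite"
  shows "eventually P (at t)"
proof -
  have "finite {x. \<not> P x}"
    using assms by (simp add: eventually_cofinite)
  then have "open (- ({x. \<not> P x} - {t}))"
    by (intro open_Compl finite_imp_closed) auto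
  then show ?thesis
    unfolding eventually_at_topological by (intro exI[of _ "- ({x. \<not> P x} - {t})"]) auto
qed

lemma eventually_cofinite_nhds:
  fixes P :: "complex \<Rightarrow> bool"
  assumes "eventually P cofinite"
  shows "\<forall>\<^sub>F x in cofinite. eventually P (nhds x)"
proof -
  have fin: "finite {x. \<not> P x}"
    using assms by (simp add: eventually_cofinite)
  then have "open {x. P x}"
    using finite_imp_closed[OF fin] by (simp add: closed_def Collect_neg_eq [symmetric] Compl_eq)
  then have "eventually P (nhds x)" if "P x" for x
    using that by (auto intro: eventually_nhds[THEN iffD2])
  with assms show ?thesis
    by (auto elim: eventually_mono)
qed

lemma laurent_expansion_rational:
  assumes "rational_fun f"
  shows "(\<lambda>z. f (t + z)) has_laurent_expansion laurent_expansion f t"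
proof -
  obtain p q where ev: "\<forall>\<^sub>F x in cofinite. f x = poly p x / poly q x"
    using assms by (auto simp: rational_fun_def)
  have "(\<lambda>z. poly p (t + z ^ 1) / poly q (t + z ^ 1)) has_laurent_expansion
      fps_to_fls (pullback_poly t 1 p) / fps_to_fls (pullback_poly t 1 q)"
    by (intro laurent_expansion_intros has_laurent_expansion_fps has_fps_expansion_pullback_poly)
  then have "(\<lambda>z. f (t + z)) has_laurent_expansion
      fps_to_fls (pullback_poly t 1 p) / fps_to_fls (pullback_poly t 1 q)"
    using has_laurent_expansion_cong'[OF eventually_at_of_cofinite[OF ev] refl refl] by simp
  then show ?thesis
    using laurent_expansion_eqI by metis
qed

text \<open>
  The matrix of the gauge transformation is lower triangular with diagonal \<open>\<alpha>, \<beta> w\<close> and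
  lower entry \<open>f\<close>, so the entries of \<open>\<Omega>\<close> can be solved for one after the other. Here \<open>w\<close> is the
  polynomial that represents \<open>\<phi>\<close>; its zeros are the points of \<open>Q\<close>, so that the correction terms
  are holomorphic at the poles.\<close>
lemma gauge_trace_det:
  assumes nf: "normal_form_of D \<Omega> Q N" and Q: "reduced_zeros D \<Omega> Q"
  obtains \<alpha> f w where "\<alpha> \<noteq> 0" "\<forall>x. x \<notin> Q \<longrightarrow> poly w x \<noteq> 0"
    "\<forall>\<^sub>F x in cofinite. trace (\<Omega> x) = nf_d D Q N x + poly (pderiv w) x / poly w x"
    "\<forall>\<^sub>F x in cofinite. det (\<Omega> x) = (- nf_c D Q N x
        + (poly f x * (poly (pderiv w) x / poly w x) - poly (pderiv f) x) / \<alpha>) / poly (div_poly D) x"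
proof -
  obtain \<alpha> \<beta> f where ab: "\<alpha> \<noteq> 0" "\<beta> \<noteq> 0" and gauge: "gauge_related
          (\<lambda>x. (vector [vector [\<alpha>, 0], vector [poly f x, \<beta>]] :: complex^2^2) **
               (vector [vector [1, 0], vector [0, phi D \<Omega> x]] :: complex^2^2))
          \<Omega> (nf_matrix D Q N)"
    using nf by (auto simp: normal_form_of_def)
  obtain \<kappa> where \<kappa>: "\<kappa> \<noteq> 0" "\<forall>\<^sub>F x in cofinite. phi D \<Omega> x = \<kappa> * (\<Prod>q\<in>Q. x - q)" and finQ: "finite Q"
    using Q by (auto simp: reduced_zeros_def)
  define w where "w = smult \<kappa> (\<Prod>q\<in>Q. [:- q, 1:])"
  have w_eq: "poly w x = \<kappa> * (\<Prod>q\<in>Q. x - q)" for x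
    by (simp add: w_def poly_prod)
  have w0: "poly w x \<noteq> 0" if "x \<notin> Q" for x
    using that \<kappa>(1) finQ by (auto simp: w_eq)
  have phi: "\<forall>\<^sub>F x in cofinite. phi D \<Omega> x = poly w x"
    using \<kappa>(2) by (simp add: w_eq)
  let ?h = "\<lambda>x. (vector [vector [\<alpha>, 0], vector [poly f x, \<beta>]] :: complex^2^2) **
               (vector [vector [1, 0], vector [0, phi D \<Omega> x]] :: complex^2^2)"
  have h: "?h x $ 1 $ 1 = \<alpha>" "?h x $ 1 $ 2 = 0" "?h x $ 2 $ 1 = poly f x" "?h x $ 2 $ 2 = \<beta> * phi D \<Omega> x" for x
    by (simp_all add: matrix_matrix_mult_def sum_2)
  have ev: "\<forall>\<^sub>F x in cofinite. poly w x \<noteq> 0 \<and> poly (div_poly D) x \<noteq> 0 \<and> phi D \<Omega> x = poly w x \<and>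
      deriv (\<lambda>z. \<beta> * phi D \<Omega> z) x = \<beta> * poly (pderiv w) x \<and>
      ?h x ** \<Omega> x = (\<chi> i j. deriv (\<lambda>z. ?h z $ i $ j) x) + nf_matrix D Q N x ** ?h x"
  proof (intro eventually_conj)
    show "\<forall>\<^sub>F x in cofinite. poly w x \<noteq> 0"
      using finite_subset[of "{x. poly w x = 0}" Q] w0 finQ by (auto simp: eventually_cofinite)
    have "div_poly D \<noteq> 0"
      by (cases "finite (fin_supp D)") (auto simp: div_poly_def)
    then show "\<forall>\<^sub>F x in cofinite. poly (div_poly D) x \<noteq> 0"
      by (simp add: eventually_cofinite poly_roots_finite)
    show "\<forall>\<^sub>F x in cofinite. phi D \<Omega> x = poly w x" by (rule phi)
    show "\<forall>\<^sub>F x in cofinite. deriv (\<lambda>z. \<beta> * phi D \<Omega> z) x = \<beta> * poly (pderiv w) x"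
      using eventually_cofinite_nhds[OF phi]
    proof eventually_elim
      case (elim x)
      then show ?case
        by (subst deriv_cong_ev[of _ "\<lambda>z. \<beta> * poly w z"])
           (auto elim: eventually_mono intro!: DERIV_imp_deriv DERIV_cmult poly_DERIV)
    qed
    show "\<forall>\<^sub>F x in cofinite. ?h x ** \<Omega> x
        = (\<chi> i j. deriv (\<lambda>z. ?h z $ i $ j) x) + nf_matrix D Q N x ** ?h x"
      using gauge unfolding gauge_related_def by (auto elim: eventually_mono)
  qed
  have key: "trace (\<Omega> x) = nf_d D Q N x + poly (pderiv w) x / poly w x \<and>
      det (\<Omega> x) = (- nf_c D Q N x
        + (poly f x * (poly (pderiv w) x / poly w x) - poly (pderiv f) x) / \<alpha>) / poly (div_poly D) x"
    if x: "poly w x \<noteq> 0" "poly (div_poly D) x \<noteq> 0" "phi D \<Omega> x = poly w x"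
      "deriv (\<lambda>z. \<beta> * phi D \<Omega> z) x = \<beta> * poly (pderiv w) x"
      and eq: "?h x ** \<Omega> x = (\<chi> i j. deriv (\<lambda>z. ?h z $ i $ j) x) + nf_matrix D Q N x ** ?h x" for x
  proof -
    define P W W' F F' c d where "P = poly (div_poly D) x" and "W = poly w x"
      and "W' = poly (pderiv w) x" and "F = poly f x" and "F' = poly (pderiv f) x"
      and "c = nf_c D Q N x" and "d = nf_d D Q N x"
    have deriv2: "deriv (\<lambda>z. \<beta> * phi D \<Omega> z) x = \<beta> * W'"
      using x(4) by (simp add: W'_def)
    have derivf: "deriv (poly f) x = F'"
      unfolding F'_def by (rule DERIV_imp_deriv[OF poly_DERIV])
    have entries: "\<alpha> * \<Omega> x $ 1 $ 1 = F / P" "\<alpha> * \<Omega> x $ 1 $ 2 = \<beta> * W / P"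
      "F * \<Omega> x $ 1 $ 1 + \<beta> * W * \<Omega> x $ 2 $ 1 = F' + (c * \<alpha> + d * F)"
      "F * \<Omega> x $ 1 $ 2 + \<beta> * W * \<Omega> x $ 2 $ 2 = \<beta> * W' + d * (\<beta> * W)"
      using arg_cong[OF eq, of "\<lambda>A. A $ 1 $ 1"] arg_cong[OF eq, of "\<lambda>A. A $ 1 $ 2"]
        arg_cong[OF eq, of "\<lambda>A. A $ 2 $ 1"] arg_cong[OF eq, of "\<lambda>A. A $ 2 $ 2"]
      by (simp_all add: matrix_matrix_mult_def sum_2 nf_matrix_def deriv2 derivf x(3)
          flip: P_def W_def W'_def F_def c_def d_def)
    have nz: "P \<noteq> 0" "W \<noteq> 0"
      using x by (simp_all add: P_def W_def)
    have a11: "\<Omega> x $ 1 $ 1 = F / (\<alpha> * P)" and a12: "\<Omega> x $ 1 $ 2 = \<beta> * W / (\<alpha> * P)"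
      using entries(1,2) ab nz by (simp_all add: field_simps)
    have a21: "\<Omega> x $ 2 $ 1 = (F' + c * \<alpha> + d * F - F * (F / (\<alpha> * P))) / (\<beta> * W)"
      using entries(3)[unfolded a11] ab nz by (simp add: field_simps)
    have a22: "\<Omega> x $ 2 $ 2 = W' / W + d - F / (\<alpha> * P)"
    proof -
      have "\<beta> * (W * \<Omega> x $ 2 $ 2) = \<beta> * (W * (W' / W + d - F / (\<alpha> * P)))"
        using entries(4)[unfolded a12] nz by (simp add: algebra_simps)
      then show ?thesis
        using ab nz by simp
    qed
    have "trace (\<Omega> x) = d + W' / W"
      by (simp add: trace_def sum_2 a11 a22)
    moreover have "det (\<Omega> x) = (- c + (F * (W' / W) - F') / \<alpha>) / P"
      unfolding det_2 a11 a12 a21 a22 using ab nz by (simp add: field_simps)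
    ultimately show ?thesis
      by (simp add: P_def W_def W'_def F_def F'_def c_def d_def)
  qed
  show ?thesis
  proof (rule that[OF ab(1)])
    show "\<forall>x. x \<notin> Q \<longrightarrow> poly w x \<noteq> 0"
      using w0 by simp
    show "\<forall>\<^sub>F x in cofinite. trace (\<Omega> x) = nf_d D Q N x + poly (pderiv w) x / poly w x"
      using ev by eventually_elim (use key in blast)
    show "\<forall>\<^sub>F x in cofinite. det (\<Omega> x) = (- nf_c D Q N x
        + (poly f x * (poly (pderiv w) x / poly w x) - poly (pderiv f) x) / \<alpha>) / poly (div_poly D) x"
      using ev by eventually_elim (use key in blast)
  qed
qed

lemma fls_below_nth: "fls_nth (fls_below k f) n = (if n < k then fls_nth f n else 0)"
  by (auto simp: fls_below_def)

lemma fls_divide_X_power_nth: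
  fixes f :: "complex fls"
  shows "fls_nth (f / fls_X ^ m) n = fls_nth f (n + int m)"
proof -
  have "f = fls_X ^ m * fls_shift (int m) f"
    by (simp add: fls_X_power_times_conv_shift)
  then have "f / fls_X ^ m = fls_shift (int m) f"
    by (metis fls_X_pow_nonzero nonzero_mult_div_cancel_left)
  then show ?thesis
    by simp
qed

text \<open>
  In both formulas of \<open>gauge_trace_det\<close> the correction terms are discarded by the truncation that
  defines the formal data: in the trace they are holomorphic at \<open>t\<close>, in the determinant they are
  divided by \<open>P\<close> and have a pole of order at most \<open>m\<close>.\<close>
lemma formal_data_normal_form:
  assumes D: "finite (supp D)" "t \<in> fin_supp D"
    and V: "in_V D \<Lambda> \<Omega> Q" "normal_form_of D \<Omega> Q N"
  defines "m \<equiv> D (Affine t)"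
    and "R \<equiv> pullback_poly t 1 (cofactor_poly D t)"
  shows "fst (\<Lambda> (Affine t)) = fls_below 0 (fps_to_fls (pullback_poly t 1 (coeff_D N t)) / fls_X ^ m)"
    and "snd (\<Lambda> (Affine t)) = fls_below (- int m)
      (- fps_to_fls (pullback_poly t 1 (coeff_C N t) * inverse R) / fls_X ^ (2 * m))"
proof -
  let ?C = "pullback_poly t 1 (coeff_C N t)" and ?D = "pullback_poly t 1 (coeff_D N t)"
  define A where "A = local_matrix \<Omega> (Affine t)"
  have rat: "rational_fun (\<lambda>x. \<Omega> x $ i $ j)" for i j
    using V(1) by (simp add: in_V_def connection_def)
  have red: "reduced_zeros D \<Omega> Q"
    using V(1) by (simp add: in_V_def)
  have Q: "Q \<inter> fin_supp D = {}"
    using red by (simp add: reduced_zeros_def)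
  have data: "\<Lambda> (Affine t) = data_at m A"
  proof -
    have "Affine t \<in> supp D"
      using D(2) by (simp add: fin_supp_def supp_def)
    moreover have "data_at (D p) (local_matrix \<Omega> p) = \<Lambda> p" if "p \<in> supp D" for p
      using V(1) that by (simp add: in_V_def)
    ultimately show ?thesis
      unfolding A_def m_def by metis
  qed
  obtain \<alpha> f w where gauge: "\<alpha> \<noteq> 0" "\<forall>x. x \<notin> Q \<longrightarrow> poly w x \<noteq> 0"
    "\<forall>\<^sub>F x in cofinite. trace (\<Omega> x) = nf_d D Q N x + poly (pderiv w) x / poly w x"
    "\<forall>\<^sub>F x in cofinite. det (\<Omega> x) = (- nf_c D Q N x
        + (poly f x * (poly (pderiv w) x / poly w x) - poly (pderiv f) x) / \<alpha>) / poly (div_poly D) x"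
    using gauge_trace_det[OF V(2) red] .
  have wt: "poly w t \<noteq> 0"
    using gauge(2) Q D(2) by blast
  have entry: "(\<lambda>z. \<Omega> (t + z) $ i $ j) has_laurent_expansion A $ i $ j" for i j
    using laurent_expansion_rational[OF rat] by (simp add: A_def)

  obtain gd where gd: "gd analytic_on {t}"
    "\<And>x. nf_d D Q N x = poly (coeff_D N t) x / (x - t) ^ m + gd x"
    using nf_d_split[OF D Q, where N = N] unfolding m_def by blast
  obtain k where k: "(\<lambda>z. gd (t + z ^ 1)) has_fps_expansion k"
    using analytic_pullback_expansion[OF gd(1) zero_less_one] .
  have l_analytic: "(\<lambda>x. poly (pderiv w) x / poly w x) analytic_on {t}"
    using wt by (auto intro!: analytic_intros poly_analytic_on)
  obtain l where l: "(\<lambda>z. poly (pderiv w) (t + z ^ 1) / poly w (t + z ^ 1)) has_fps_expansion l"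
    using analytic_pullback_expansion[OF l_analytic zero_less_one] .
  have "(\<lambda>z. trace (\<Omega> (t + z))) has_laurent_expansion trace A"
    unfolding trace_def sum_2 by (intro laurent_expansion_intros entry)
  then have tr1: "(\<lambda>z. nf_d D Q N (t + z) + poly (pderiv w) (t + z) / poly w (t + z))
      has_laurent_expansion trace A"
    using has_laurent_expansion_cong'[OF eventually_at_of_cofinite[OF gauge(3)] refl refl] by simp
  have tr2: "(\<lambda>z. nf_d D Q N (t + z ^ 1) + poly (pderiv w) (t + z ^ 1) / poly w (t + z ^ 1))
      has_laurent_expansion fps_to_fls ?D / fls_X ^ (1 * m) + fps_to_fls k + fps_to_fls l"
    by (intro has_laurent_expansion_add principal_part_expansion[OF k gd(2)] has_laurent_expansion_fps[OF l])
  have tr: "trace A = fps_to_fls ?D / fls_X ^ m + fps_to_fls (k + l)"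
    using has_laurent_expansion_unique[OF tr1 tr2[unfolded power_one_right mult_1]]
    by (simp only: fps_to_fls_plus add.assoc)
  show "fst (\<Lambda> (Affine t)) = fls_below 0 (fps_to_fls ?D / fls_X ^ m)"
    unfolding data data_at_def fst_conv tr
    by (rule fls_eqI) (simp add: fls_below_nth)

  obtain gc where gc: "gc analytic_on {t}"
    "\<And>x. nf_c D Q N x = poly (coeff_C N t) x / (x - t) ^ m + gc x"
    using nf_c_split[OF D Q, where N = N] unfolding m_def by blast
  obtain g where g: "(\<lambda>z. gc (t + z ^ 1)) has_fps_expansion g"
    using analytic_pullback_expansion[OF gc(1) zero_less_one] .
  let ?r = "\<lambda>x. (poly f x * (poly (pderiv w) x / poly w x) - poly (pderiv f) x) / \<alpha>"
  have r_analytic: "?r analytic_on {t}"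
    using wt gauge(1) by (auto intro!: analytic_intros poly_analytic_on)
  obtain r where r: "(\<lambda>z. ?r (t + z ^ 1)) has_fps_expansion r"
    using analytic_pullback_expansion[OF r_analytic zero_less_one] .
  have "fps_nth R 0 \<noteq> 0"
    using cofactor_poly_nonzero[OF D(1)] by (simp add: R_def pullback_poly_nth_0)
  then have R: "R * inverse R = 1" "R \<noteq> 0"
    using inverse_mult_eq_1' by auto
  have P: "pullback_poly t 1 (div_poly D) = fps_X ^ (1 * m) * R"
    by (simp only: div_poly_split[OF D(1,2)] pullback_poly_mult pullback_poly_linear_power R_def m_def)
  have "(\<lambda>z. det (\<Omega> (t + z))) has_laurent_expansion det A"
    unfolding det_2 by (intro laurent_expansion_intros entry)
  then have det1: "(\<lambda>z. (- nf_c D Q N (t + z) + ?r (t + z)) / poly (div_poly D) (t + z))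
      has_laurent_expansion det A"
    using has_laurent_expansion_cong'[OF eventually_at_of_cofinite[OF gauge(4)] refl refl] by simp
  have det2: "(\<lambda>z. (- nf_c D Q N (t + z ^ 1) + ?r (t + z ^ 1)) / poly (div_poly D) (t + z ^ 1))
      has_laurent_expansion (- (fps_to_fls ?C / fls_X ^ (1 * m) + fps_to_fls g) + fps_to_fls r)
        / fps_to_fls (fps_X ^ (1 * m) * R)"
    unfolding P [symmetric]
    by (intro has_laurent_expansion_add has_laurent_expansion_minus has_laurent_expansion_divide
        principal_part_expansion[OF g gc(2)] has_laurent_expansion_fps[OF r]
        has_laurent_expansion_fps[OF has_fps_expansion_pullback_poly])
  have "det A = (- (fps_to_fls ?C / fls_X ^ m + fps_to_fls g) + fps_to_fls r)
        / fps_to_fls (fps_X ^ m * R)"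
    using has_laurent_expansion_unique[OF det1 det2[unfolded power_one_right mult_1]] .
  moreover have "inverse (fps_to_fls R) = fps_to_fls (inverse R)"
    by (rule inverse_unique) (simp flip: fls_times_fps_to_fls add: R(1))
  ultimately have "det A = (- (fps_to_fls ?C / fls_X ^ m + fps_to_fls g) + fps_to_fls r)
        * (fps_to_fls (inverse R) / fls_X ^ m)"
    by (simp only: fls_times_fps_to_fls fps_to_fls_X_power divide_inverse inverse_mult_distrib mult.commute)
  moreover have "(- (c / X + h) + s) * (i / X) = - (c * i) / (X * X) + (s - h) * i / X"
    if "X \<noteq> 0" for c h s i X :: "complex fls"
    using that by (simp add: field_simps)
  ultimately have det: "det A = - fps_to_fls (?C * inverse R) / fls_X ^ (2 * m)
      + fps_to_fls ((r - g) * inverse R) / fls_X ^ m"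
    by (simp only: fls_times_fps_to_fls fps_to_fls_minus mult_2 power_add fls_X_pow_nonzero not_False_eq_True)
  show "snd (\<Lambda> (Affine t)) = fls_below (- int m) (- fps_to_fls (?C * inverse R) / fls_X ^ (2 * m))"
    unfolding data data_at_def snd_conv det
    by (rule fls_eqI) (simp add: fls_below_nth fls_divide_X_power_nth)
qed

lemma formal_data_coefficients:
  assumes D: "finite (supp D)" "t \<in> fin_supp D"
    and V: "in_V D \<Lambda> \<Omega> Q" "normal_form_of D \<Omega> Q N" and "j < D (Affine t)"
  shows "fls_nth (fst (\<Lambda> (Affine t))) (int j - int (D (Affine t))) = fps_nth (pullback_poly t 1 (coeff_D N t)) j"
    and "fls_nth (snd (\<Lambda> (Affine t))) (int j - 2 * int (D (Affine t)))
      = - fps_nth (pullback_poly t 1 (coeff_C N t) * inverse (pullback_poly t 1 (cofactor_poly D t))) j"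
  unfolding formal_data_normal_form[OF D V] using assms(5)
  by (simp_all add: fls_below_nth fls_divide_X_power_nth)

text \<open>
  The polar parts give the coefficients of \<open>D\<close> and of \<open>C / R\<close> below order \<open>m\<close>. Since the cofactor
  \<open>R\<close> is a unit and \<open>C\<close> and \<open>D\<close> have degree less than \<open>m\<close>, this recovers both polynomials.\<close>
lemma formal_data_determines_coefficients:
  assumes D: "finite (supp D)" "t \<in> fin_supp D"
    and V: "in_V D \<Lambda> \<Omega> Q" "normal_form_of D \<Omega> Q N"
    and V': "in_V D \<Lambda> \<Omega>' Q'" "normal_form_of D \<Omega>' Q' N'"
  shows "coeff_C N t = coeff_C N' t" "coeff_D N t = coeff_D N' t"
proof -
  let ?m = "D (Affine t)" and ?p = "pullback_poly t 1" and ?R = "pullback_poly t 1 (cofactor_poly D t)"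
  have deg: "degree (coeff_C N t) < ?m" "degree (coeff_D N t) < ?m"
    "degree (coeff_C N' t) < ?m" "degree (coeff_D N' t) < ?m"
    using D(2) V(2) V'(2) by (auto simp: normal_form_of_def nf_bounds_def)
  show "coeff_D N t = coeff_D N' t"
  proof (rule pullback_poly_1_cong_inject[OF _ deg(2,4)])
    show "fps_cutoff ?m (?p (coeff_D N t)) = fps_cutoff ?m (?p (coeff_D N' t))"
      unfolding fps_cutoff_eq_fps_cutoff_iff
      using formal_data_coefficients(1)[OF D V] formal_data_coefficients(1)[OF D V'] by metis
  qed
  have "fps_nth ?R 0 \<noteq> 0"
    using cofactor_poly_nonzero[OF D(1)] by (simp add: pullback_poly_nth_0)
  then have R: "inverse ?R * ?R = 1"
    by (rule inverse_mult_eq_1)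
  have "fps_cutoff ?m (?p (coeff_C N t) * inverse ?R) = fps_cutoff ?m (?p (coeff_C N' t) * inverse ?R)"
    unfolding fps_cutoff_eq_fps_cutoff_iff
    using formal_data_coefficients(2)[OF D V] formal_data_coefficients(2)[OF D V']
    by (metis neg_equal_iff_equal)
  then have "fps_X ^ ?m dvd (?p (coeff_C N t) * inverse ?R - ?p (coeff_C N' t) * inverse ?R) * ?R"
    unfolding fps_cutoff_eq_iff_dvd by (rule dvd_mult2)
  also have "\<dots> = ?p (coeff_C N t) - ?p (coeff_C N' t)"
    using R by (simp add: left_diff_distrib mult.assoc)
  finally show "coeff_C N t = coeff_C N' t"
    by (intro pullback_poly_1_cong_inject[OF _ deg(1,3)]) (simp only: fps_cutoff_eq_iff_dvd)
qed

text \<open>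
  Up to the unit \<open>R\<^sup>2\<close> and the factor \<open>(x - t)\<^bsup>2m\<^esup>\<close>, the discriminant of the quadratic equation
  is that of the formal data, as far as the latter is known: below relative order \<open>m\<close>, which is at
  least 2.\<close>
lemma ramified_discriminant:
  assumes D: "finite (supp D)" "t \<in> fin_supp D"
    and V: "in_V D \<Lambda> \<Omega> Q" "normal_form_of D \<Omega> Q N"
    and ram: "ramified D \<Lambda> (Affine t)"
  defines "\<Delta> \<equiv> (cofactor_poly D t * coeff_D N t)\<^sup>2 + 4 * (cofactor_poly D t * coeff_C N t)"
  shows "fps_nth (pullback_poly t 1 \<Delta>) 0 = 0" "fps_nth (pullback_poly t 1 \<Delta>) 1 \<noteq> 0"
proof -
  let ?m = "D (Affine t)" and ?R = "pullback_poly t 1 (cofactor_poly D t)"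
    and ?C = "pullback_poly t 1 (coeff_C N t)" and ?D = "pullback_poly t 1 (coeff_D N t)"
  have m: "1 < ?m" and sub: "fls_subdegree (discriminant (\<Lambda> (Affine t))) = - (2 * int ?m - 1)"
    using ram by (auto simp: ramified_def)
  have deg: "degree (coeff_D N t) < ?m"
    using D(2) V(2) by (auto simp: normal_form_of_def nf_bounds_def)
  define S where "S = ?D\<^sup>2 + 4 * (?C * inverse ?R)"
  have fst: "fst (\<Lambda> (Affine t)) = fps_to_fls ?D / fls_X ^ ?m"
    unfolding formal_data_normal_form(1)[OF D V]
    by (rule fls_eqI) (use pullback_poly_1_nth_ge[OF deg] in \<open>auto simp: fls_below_nth fls_divide_X_power_nth\<close>)
  have disc: "fls_nth (discriminant (\<Lambda> (Affine t))) (int j - 2 * int ?m) = fps_nth S j" if "j < ?m" for j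
  proof -
    have "(fps_to_fls ?D / fls_X ^ ?m)\<^sup>2 = fps_to_fls (?D\<^sup>2) / fls_X ^ (2 * ?m)"
      by (simp only: power_divide fps_to_fls_power power_mult [symmetric] mult.commute)
    moreover have "fls_nth (4 * f) n = 4 * fls_nth f n" for f :: "complex fls" and n :: int
      by simp
    ultimately show ?thesis
      using formal_data_coefficients(2)[OF D V that]
      by (simp add: discriminant_def fst fls_divide_X_power_nth S_def numeral_fps_const)
  qed
  have S0: "fps_nth S 0 = 0"
    using disc[of 0] m sub by simp
  have "discriminant (\<Lambda> (Affine t)) \<noteq> 0"
    using sub m by auto
  then have S1: "fps_nth S 1 \<noteq> 0"
    using disc[of 1] m sub by (metis minus_diff_eq nth_fls_subdegree_nonzero of_nat_1)
  have R0: "fps_nth ?R 0 \<noteq> 0"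
    using cofactor_poly_nonzero[OF D(1)] by (simp add: pullback_poly_nth_0)
  then have R: "inverse ?R * ?R = 1"
    by (rule inverse_mult_eq_1)
  have "pullback_poly t 1 4 = 4"
    by (simp add: pullback_poly_def numeral_poly pcompose_const)
  then have "pullback_poly t 1 \<Delta> = (?R * ?D)\<^sup>2 + 4 * (?R * ?C)"
    by (simp add: \<Delta>_def pullback_poly_add pullback_poly_mult power2_eq_square)
  also have "\<dots> = ?R\<^sup>2 * S"
    using R unfolding S_def by algebra
  finally have eq: "pullback_poly t 1 \<Delta> = ?R\<^sup>2 * S" .
  show "fps_nth (pullback_poly t 1 \<Delta>) 0 = 0" "fps_nth (pullback_poly t 1 \<Delta>) 1 \<noteq> 0"
    unfolding eq using S0 S1 R0 by (simp_all add: fps_mult_nth power2_eq_square)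
qed

section \<open>The two branches of a formal decomposition\<close>

lemma decomposition_riccati:
  assumes D: "finite (supp D)" "t \<in> fin_supp D" "Q \<inter> fin_supp D = {}"
    and b: "b + a = Suc a * D (Affine t)" "0 < b"
    and dec: "formal_decomposition (Suc a) (pullback_matrix (nf_matrix D Q N) t (Suc a)) Lp Lm"
  defines "R \<equiv> pullback_poly t (Suc a) (cofactor_poly D t)"
  defines "G \<equiv> R * pullback_poly t (Suc a) (coeff_C N t)"
    and "H \<equiv> R * pullback_poly t (Suc a) (coeff_D N t)"
    and "T \<equiv> fps_const (1 / of_nat (Suc a)) * R"
  obtains y w g k where "Lp = formal_line (vector [1, y])" "Lm = formal_line (vector [1, w])"
    "riccati a b T G H g k y" "riccati a b T G H g k w" "y \<noteq> w"
    "a = 0 \<Longrightarrow> fps_nth y 0 \<noteq> fps_nth w 0"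
proof -
  define A :: "complex fls^2^2" where "A = pullback_matrix (nf_matrix D Q N) t (Suc a)"
  obtain g k where A: "A $ 1 $ 1 = 0" "fps_to_fls (fps_X ^ b * T) * A $ 1 $ 2 = 1"
    "fps_to_fls (fps_X ^ b * T) * A $ 2 $ 1 = fps_to_fls (G + fps_X ^ (b + a) * g)"
    "fps_to_fls (fps_X ^ b * T) * A $ 2 $ 2 = fps_to_fls (H + fps_X ^ (b + a) * k)"
    using pullback_nf_matrix[OF D b(1), where N = N, folded A_def]
    unfolding T_def G_def H_def R_def by blast
  have L: "formal_line_subbundle Lp" "formally_invariant A Lp"
    "formal_line_subbundle Lm" "formally_invariant A Lm" "Lp \<inter> Lm = {0}"
    "a = 0 \<Longrightarrow> \<exists>u\<in>Lp. \<exists>v\<in>Lm. s = u + v" for s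
    using dec by (auto simp: formal_decomposition_def A_def)
  obtain y where y: "Lp = formal_line (vector [1, y])" "riccati a b T G H g k y"
    using invariant_line_riccati[OF A b(2) L(1,2)] .
  obtain w where w: "Lm = formal_line (vector [1, w])" "riccati a b T G H g k w"
    using invariant_line_riccati[OF A b(2) L(3,4)] .
  have "y \<noteq> w"
  proof
    assume "y = w"
    then have "vector [1, y] \<in> Lp \<inter> Lm"
      using y(1) w(1) unfolding formal_line_def by (auto intro!: range_eqI[of _ _ 1])
    then have "(vector [1, y] :: complex fps^2) = 0"
      using L(5) by simp
    then show False
      by (simp add: vec_eq_iff forall_2)
  qed
  moreover have "fps_nth y 0 \<noteq> fps_nth w 0" if a0: "a = 0"
  proof
    assume eq: "fps_nth y 0 = fps_nth w 0"
    obtain p q where "vector [0, 1] = p *s vector [1, y] + q *s (vector [1, w] :: complex fps^2)"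
      using L(6)[OF a0, of "vector [0, 1]"] by (auto simp: y(1) w(1) formal_line_def)
    then have "0 = p + q" "1 = p * y + q * w"
      by (simp_all add: vec_eq_iff forall_2)
    then have "q = - p" "p * (y - w) = 1"
      by (simp_all add: eq_neg_iff_add_eq_0 add.commute) (simp add: right_diff_distrib add_eq_0_iff)
    from arg_cong[OF this(2), of "\<lambda>f. fps_nth f 0"] eq show False
      by simp
  qed
  ultimately show ?thesis
    using that y w by blast
qed

text \<open>
  In the unramified case the constant terms of the two branches are distinct roots of the quadratic
  equation at \<open>z = 0\<close>, which makes the discriminant a unit there. This argument also covers simple
  poles, where the formal data put no condition on the discriminant.\<close>
lemma discriminant_order:
  assumes D: "finite (supp D)" "t \<in> fin_supp D"
    and V: "in_V D \<Lambda> \<Omega> Q" "normal_form_of D \<Omega> Q N"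
    and a: "ram_index D \<Lambda> (Affine t) = Suc a"
    and dec: "formal_decomposition (Suc a) (pullback_matrix (nf_matrix D Q N) t (Suc a)) Lp Lm"
  defines "R \<equiv> pullback_poly t (Suc a) (cofactor_poly D t)"
  defines "G \<equiv> R * pullback_poly t (Suc a) (coeff_C N t)"
    and "H \<equiv> R * pullback_poly t (Suc a) (coeff_D N t)"
  shows "H\<^sup>2 + 4 * G \<noteq> 0" "subdegree (H\<^sup>2 + 4 * G) = 2 * a"
proof -
  have "H\<^sup>2 + 4 * G \<noteq> 0 \<and> subdegree (H\<^sup>2 + 4 * G) = 2 * a"
  proof (cases "ramified D \<Lambda> (Affine t)")
    case True
    then have a1: "a = 1"
      using a by (simp add: ram_index_def)
    define \<Delta> where "\<Delta> = (cofactor_poly D t * coeff_D N t)\<^sup>2 + 4 * (cofactor_poly D t * coeff_C N t)"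
    have "pullback_poly t (Suc a) 4 = 4"
      by (simp add: pullback_poly_def numeral_poly pcompose_const)
    then have "pullback_poly t (Suc a) \<Delta> = H\<^sup>2 + 4 * G"
      by (simp add: \<Delta>_def G_def H_def R_def pullback_poly_add pullback_poly_mult power2_eq_square)
    with subdegree_pullback_simple_zero[OF ramified_discriminant[OF D V True], of "Suc a"]
    show ?thesis
      by (simp add: a1 \<Delta>_def)
  next
    case False
    then have a0: "a = 0"
      using a by (simp add: ram_index_def)
    have Q: "Q \<inter> fin_supp D = {}"
      using V(1) by (auto simp: in_V_def reduced_zeros_def)
    have b: "D (Affine t) + a = Suc a * D (Affine t)" "0 < D (Affine t)"
      using D(2) by (simp_all add: a0 fin_supp_def)
    obtain y w g k T where yw: "riccati a (D (Affine t)) T G H g k y" "riccati a (D (Affine t)) T G H g k w"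
      "fps_nth y 0 \<noteq> fps_nth w 0"
      using decomposition_riccati[OF D Q b dec, folded R_def, folded G_def H_def] a0 by metis
    have quad: "(fps_nth u 0)\<^sup>2 = fps_nth G 0 + fps_nth u 0 * fps_nth H 0"
      if "riccati a (D (Affine t)) T G H g k u" for u
      using arg_cong[OF that[unfolded riccati_def], of "\<lambda>f. fps_nth f 0"] b(2)
      by (simp add: power2_eq_square)
    have "(fps_nth y 0 - fps_nth w 0) * (fps_nth y 0 + fps_nth w 0 - fps_nth H 0) = 0"
      using quad[OF yw(1)] quad[OF yw(2)] by algebra
    then have "fps_nth H 0 = fps_nth y 0 + fps_nth w 0"
      using yw(3) by simp
    moreover from this have "fps_nth G 0 = - (fps_nth y 0 * fps_nth w 0)"
      using quad[OF yw(1)] by algebra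
    ultimately have "fps_nth (H\<^sup>2 + 4 * G) 0 = (fps_nth y 0 - fps_nth w 0)\<^sup>2"
      by (simp add: power2_eq_square algebra_simps)
    then have "fps_nth (H\<^sup>2 + 4 * G) 0 \<noteq> 0"
      using yw(3) by simp
    then show ?thesis
      unfolding a0 by (metis fps_zero_nth mult_0_right subdegree_eq_0)
  qed
  then show "H\<^sup>2 + 4 * G \<noteq> 0" "subdegree (H\<^sup>2 + 4 * G) = 2 * a"
    by auto
qed

text \<open>
  For \<open>a = 0\<close> the two branches are close to different roots because they already differ at
  \<open>z = 0\<close>.\<close>
lemma decomposition_near_roots:
  assumes D: "finite (supp D)" "t \<in> fin_supp D" "Q \<inter> fin_supp D = {}"
    and b: "b + a = Suc a * D (Affine t)" "2 * a < b"
    and dec: "formal_decomposition (Suc a) (pullback_matrix (nf_matrix D Q N) t (Suc a)) Lp Lm"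
  defines "R \<equiv> pullback_poly t (Suc a) (cofactor_poly D t)"
  defines "G \<equiv> R * pullback_poly t (Suc a) (coeff_C N t)"
    and "H \<equiv> R * pullback_poly t (Suc a) (coeff_D N t)"
    and "T \<equiv> fps_const (1 / of_nat (Suc a)) * R"
  assumes roots: "y1 + y2 = H" "y1 * y2 = - G" "y1 \<noteq> y2" "subdegree (y1 - y2) = a"
  obtains y w g k where "Lp = formal_line (vector [1, y])" "Lm = formal_line (vector [1, w])"
    "riccati a b T G H g k y" "riccati a b T G H g k w"
    "fps_X ^ (b - a) dvd y - y1 \<and> fps_X ^ (b - a) dvd w - y2 \<or>
     fps_X ^ (b - a) dvd y - y2 \<and> fps_X ^ (b - a) dvd w - y1"
proof -
  have b0: "0 < b"
    using b(2) by simp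
  obtain y w g k where yw: "Lp = formal_line (vector [1, y])" "Lm = formal_line (vector [1, w])"
    and ric: "riccati a b T G H g k y" "riccati a b T G H g k w"
    and sep: "y \<noteq> w" "a = 0 \<Longrightarrow> fps_nth y 0 \<noteq> fps_nth w 0"
    using decomposition_riccati[OF D b(1) b0 dec, folded R_def, folded G_def H_def T_def] by blast
  have roots': "y2 + y1 = H" "y2 \<noteq> y1" "subdegree (y2 - y1) = a"
    using roots by (simp_all add: ac_simps)
  have separated: "\<not> fps_X ^ (b - a) dvd w - z"
    if "z + z' = H" "z \<noteq> z'" "subdegree (z - z') = a" "fps_X ^ (b - a) dvd y - z" for z z'
  proof (cases "a = 0")
    case True
    show ?thesis
    proof
      assume "fps_X ^ (b - a) dvd w - z"
      with that(4) have "fps_nth (y - z) 0 = 0" "fps_nth (w - z) 0 = 0"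
        using b0 True unfolding fps_X_power_dvd_iff by simp_all
      with sep(2)[OF True] show False
        by simp
    qed
  next
    case False
    then show ?thesis
      using riccati_separated[OF ric sep(1) that(1-3) b(2) _ that(4)] by simp
  qed
  have "fps_X ^ (b - a) dvd y - y1 \<and> fps_X ^ (b - a) dvd w - y2 \<or>
     fps_X ^ (b - a) dvd y - y2 \<and> fps_X ^ (b - a) dvd w - y1"
    using riccati_near_root[OF ric(1) roots b(2)] riccati_near_root[OF ric(2) roots b(2)]
      separated[OF roots(1,3,4)] separated[OF roots'] by blast
  with yw ric show ?thesis
    by (rule that)
qed

theorem corollary18:
  fixes D :: divisor and \<Lambda> :: formal_data and t :: complex
    and \<Omega> :: "complex \<Rightarrow> complex^2^2" and Q :: "complex set" and N :: nf_coeffs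
    and Lp Lm :: "(complex fps^2) set"
  defines "m \<equiv> D (Affine t)" and "e \<equiv> ram_index D \<Lambda> (Affine t)"
  assumes "finite (supp D)" and "D Infty \<ge> 1"
    and "fuchs_relation D \<Lambda>"
    and "\<forall>p\<in>supp D. unramified D \<Lambda> p \<or> ramified D \<Lambda> p"
    and "t \<in> fin_supp D"
    and "in_V D \<Lambda> \<Omega> Q" and "normal_form_of D \<Omega> Q N"
    and "formal_decomposition e (pullback_matrix (nf_matrix D Q N) t e) Lp Lm"
  shows
    "(\<exists>yp ym. yp \<noteq> ym \<and> {y. y\<^sup>2 = quadratic_rhs D N t e y} = {yp, ym} \<and>
        (\<forall>(L, y) \<in> {(Lp, yp), (Lm, ym)}.
           (unramified D \<Lambda> (Affine t) \<longrightarrow>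
              line_jet e (m - 1) L
                = line_jet e (m - 1) (formal_line (vector [1, jet e (m - 1) y]))) \<and>
           (ramified D \<Lambda> (Affine t) \<longrightarrow>
              (\<exists>Y. line_jet e (m - 1) L
                     = line_jet e (m - 1) (formal_line (vector [1, jet e (m - 1) Y])) \<and>
                   jet e (m - 1) (Y\<^sup>2) = jet e (m - 1) (quadratic_rhs D N t e Y) \<and>
                   fps_cutoff (e * (m - 1)) Y = fps_cutoff (e * (m - 1)) y)))) \<and>
     (\<forall>\<Omega>' Q' N' Lp' Lm'.
        in_V D \<Lambda> \<Omega>' Q' \<and> normal_form_of D \<Omega>' Q' N' \<and>
        formal_decomposition e (pullback_matrix (nf_matrix D Q' N') t e) Lp' Lm' \<longrightarrow>
        {line_jet e (m - 1) Lp', line_jet e (m - 1) Lm'}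
          = {line_jet e (m - 1) Lp, line_jet e (m - 1) Lm})"
proof -
  note D = \<open>finite (supp D)\<close> \<open>t \<in> fin_supp D\<close>
  note V = \<open>in_V D \<Lambda> \<Omega> Q\<close> \<open>normal_form_of D \<Omega> Q N\<close>
  obtain a where e: "e = Suc a" and a1: "a \<le> 1"
    and ram: "ramified D \<Lambda> (Affine t) \<longleftrightarrow> a = 1"
    unfolding e_def ram_index_def by (cases "ramified D \<Lambda> (Affine t)") auto
  have unram: "a = 0" if "unramified D \<Lambda> (Affine t)"
  proof -
    have "\<not> ramified D \<Lambda> (Affine t)"
      using that by (auto simp: unramified_def ramified_def)
    then show ?thesis
      using ram a1 by simp
  qed
  \<comment> \<open>A jet of order \<open>m - 1\<close> in \<open>x - t\<close> is the truncation modulo \<open>z\<^sup>b\<close>.\<close>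
  define b where "b = e * (m - 1) + 1"
  have m: "1 \<le> m" "a = 1 \<Longrightarrow> 2 \<le> m"
    using D(2) ram by (auto simp: m_def fin_supp_def ramified_def)
  obtain l where l: "m = Suc l"
    using m(1) by (cases m) auto
  have "a = 0 \<or> a = 1"
    using a1 by auto
  then have b: "b + a = Suc a * D (Affine t)" "2 * a < b"
    using m by (auto simp: b_def e l simp flip: m_def)
  have b0: "0 < b"
    using b(2) by simp
  have jet: "jet e (m - 1) = fps_cutoff b"
    by (simp add: jet_def b_def fun_eq_iff)
  define R where "R = pullback_poly t (Suc a) (cofactor_poly D t)"
  define G where "G = R * pullback_poly t (Suc a) (coeff_C N t)"
  define H where "H = R * pullback_poly t (Suc a) (coeff_D N t)"
  define T where "T = fps_const (1 / of_nat (Suc a)) * R"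
  define J :: "complex fps \<Rightarrow> (complex fps^2) set"
    where "J y = line_jet e (m - 1) (formal_line (vector [1, y]))" for y
  have J_cong: "J y = J w" if "fps_X ^ b dvd y - w" for y w
    unfolding J_def by (rule line_jet_cong) (simp only: jet fps_cutoff_eq_iff_dvd that)
  have J_jet: "J (jet e (m - 1) y) = J y" for y
    unfolding J_def jet by (rule line_jet_cong) (simp add: jet fps_eq_iff del: One_nat_def)
  have rhs: "quadratic_rhs D N t e y = G + y * H" for y
    by (simp add: quadratic_rhs_def G_def H_def R_def e algebra_simps)
  have Q: "Q \<inter> fin_supp D = {}"
    using V(1) by (auto simp: in_V_def reduced_zeros_def)
  have dec: "formal_decomposition (Suc a) (pullback_matrix (nf_matrix D Q N) t (Suc a)) Lp Lm"
    using \<open>formal_decomposition e _ Lp Lm\<close> unfolding e .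
  have ind: "ram_index D \<Lambda> (Affine t) = Suc a"
    using e by (simp add: e_def)
  obtain y1 y2 where roots: "y1 + y2 = H" "y1 * y2 = - G" "y1 \<noteq> y2" "subdegree (y1 - y2) = a"
    using quadratic_roots[OF discriminant_order[OF D V ind dec, folded R_def, folded G_def H_def]] .
  have roots': "y2 + y1 = H" "y2 * y1 = - G" "y2 \<noteq> y1" "subdegree (y2 - y1) = a"
    using roots by (simp_all add: ac_simps)
  obtain y w g k where yw: "Lp = formal_line (vector [1, y])" "Lm = formal_line (vector [1, w])"
    and ric: "riccati a b T G H g k y" "riccati a b T G H g k w"
    and near: "fps_X ^ (b - a) dvd y - y1 \<and> fps_X ^ (b - a) dvd w - y2 \<or>
     fps_X ^ (b - a) dvd y - y2 \<and> fps_X ^ (b - a) dvd w - y1"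
    using decomposition_near_roots[OF D Q b dec, folded R_def, folded G_def H_def T_def, OF roots] by blast

  have jets: "(unramified D \<Lambda> (Affine t) \<longrightarrow>
              line_jet e (m - 1) L
                = line_jet e (m - 1) (formal_line (vector [1, jet e (m - 1) z]))) \<and>
           (ramified D \<Lambda> (Affine t) \<longrightarrow>
              (\<exists>Y. line_jet e (m - 1) L
                     = line_jet e (m - 1) (formal_line (vector [1, jet e (m - 1) Y])) \<and>
                   jet e (m - 1) (Y\<^sup>2) = jet e (m - 1) (quadratic_rhs D N t e Y) \<and>
                   fps_cutoff (e * (m - 1)) Y = fps_cutoff (e * (m - 1)) z))"
    (is "?branch L z")
    if L: "L = formal_line (vector [1, u])" and u: "riccati a b T G H g k u" "fps_X ^ (b - a) dvd u - z"
    for L u z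
  proof (intro conjI impI)
    assume "unramified D \<Lambda> (Affine t)"
    then have "J u = J z"
      using u(2) unram by (intro J_cong) simp
    then show "line_jet e (m - 1) L = line_jet e (m - 1) (formal_line (vector [1, jet e (m - 1) z]))"
      unfolding L J_def [symmetric] J_jet .
  next
    \<comment> \<open>The branch \<open>u\<close> of the decomposition itself serves as the approximate solution \<open>Y\<close>.\<close>
    assume "ramified D \<Lambda> (Affine t)"
    then have "b - a = e * (m - 1)"
      using ram by (simp add: b_def)
    then have "fps_cutoff (e * (m - 1)) u = fps_cutoff (e * (m - 1)) z"
      using u(2) by (simp add: fps_cutoff_eq_iff_dvd)
    moreover have "jet e (m - 1) (u\<^sup>2) = jet e (m - 1) (quadratic_rhs D N t e u)"
      using u(1) by (simp add: jet fps_cutoff_eq_iff_dvd rhs riccati_def del: One_nat_def)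
    moreover have "line_jet e (m - 1) L = line_jet e (m - 1) (formal_line (vector [1, jet e (m - 1) u]))"
      unfolding L J_def [symmetric] J_jet ..
    ultimately show "\<exists>Y. line_jet e (m - 1) L
                     = line_jet e (m - 1) (formal_line (vector [1, jet e (m - 1) Y])) \<and>
                   jet e (m - 1) (Y\<^sup>2) = jet e (m - 1) (quadratic_rhs D N t e Y) \<and>
                   fps_cutoff (e * (m - 1)) Y = fps_cutoff (e * (m - 1)) z"
      by blast
  qed
  obtain yp ym where rp: "yp + ym = H" "yp * ym = - G" "yp \<noteq> ym" "subdegree (yp - ym) = a"
    and yy: "fps_X ^ (b - a) dvd y - yp" "fps_X ^ (b - a) dvd w - ym"
    using near roots roots' by blast
  have rm: "ym + yp = H" "ym \<noteq> yp" "subdegree (ym - yp) = a"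
    using rp by (simp_all add: ac_simps)
  have sols: "{y. y\<^sup>2 = quadratic_rhs D N t e y} = {yp, ym}"
    unfolding rhs by (rule quadratic_roots_unique[OF rp(1,2)])

  have indep: "{line_jet e (m - 1) Lp', line_jet e (m - 1) Lm'}
          = {line_jet e (m - 1) Lp, line_jet e (m - 1) Lm}"
    if V': "in_V D \<Lambda> \<Omega>' Q'" "normal_form_of D \<Omega>' Q' N'"
      and dec': "formal_decomposition e (pullback_matrix (nf_matrix D Q' N') t e) Lp' Lm'"
    for \<Omega>' Q' N' Lp' Lm'
  proof -
    have Q': "Q' \<inter> fin_supp D = {}"
      using V'(1) by (auto simp: in_V_def reduced_zeros_def)
    \<comment> \<open>The Riccati equations of both connections share \<open>T, G, H\<close>, hence the roots \<open>yp, ym\<close>.\<close>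
    note coeffs = formal_data_determines_coefficients[OF D V V']
    obtain y' w' g' k' where yw': "Lp' = formal_line (vector [1, y'])" "Lm' = formal_line (vector [1, w'])"
      and ric': "riccati a b T G H g' k' y'" "riccati a b T G H g' k' w'"
      and near': "fps_X ^ (b - a) dvd y' - yp \<and> fps_X ^ (b - a) dvd w' - ym \<or>
       fps_X ^ (b - a) dvd y' - ym \<and> fps_X ^ (b - a) dvd w' - yp"
      using decomposition_near_roots[OF D Q' b dec'[unfolded e], folded coeffs,
          folded R_def, folded G_def H_def T_def, OF rp] by blast
    note same = J_cong[OF riccati_unique_jet[OF _ _ rp(1,3,4) b(2)]] J_cong[OF riccati_unique_jet[OF _ _ rm b(2)]]
    have "J y' = J y \<and> J w' = J w \<or> J y' = J w \<and> J w' = J y"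
      using near'
    proof
      assume "fps_X ^ (b - a) dvd y' - yp \<and> fps_X ^ (b - a) dvd w' - ym"
      then have "J y' = J y" "J w' = J w"
        using same(1)[OF ric'(1) ric(1) _ yy(1)] same(2)[OF ric'(2) ric(2) _ yy(2)] by simp_all
      then show ?thesis by simp
    next
      assume "fps_X ^ (b - a) dvd y' - ym \<and> fps_X ^ (b - a) dvd w' - yp"
      then have "J y' = J w" "J w' = J y"
        using same(2)[OF ric'(1) ric(2) _ yy(2)] same(1)[OF ric'(2) ric(1) _ yy(1)] by simp_all
      then show ?thesis by simp
    qed
    then show ?thesis
      unfolding yw yw' J_def [symmetric] by auto
  qed
  have "?branch Lp yp" "?branch Lm ym"
    using jets[OF yw(1) ric(1) yy(1)] jets[OF yw(2) ric(2) yy(2)] by blast+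
  then have branches: "\<forall>(L, z) \<in> {(Lp, yp), (Lm, ym)}. ?branch L z"
    unfolding ball_simps prod.case by blast
  show ?thesis
  proof (intro conjI exI)
    show "yp \<noteq> ym" by (rule rp(3))
    show "{y. y\<^sup>2 = quadratic_rhs D N t e y} = {yp, ym}" by (rule sols)
    show "\<forall>(L, z) \<in> {(Lp, yp), (Lm, ym)}. ?branch L z" by (rule branches)
  next
    show "\<forall>\<Omega>' Q' N' Lp' Lm'.
        in_V D \<Lambda> \<Omega>' Q' \<and> normal_form_of D \<Omega>' Q' N' \<and>
        formal_decomposition e (pullback_matrix (nf_matrix D Q' N') t e) Lp' Lm' \<longrightarrow>
        {line_jet e (m - 1) Lp', line_jet e (m - 1) Lm'}
          = {line_jet e (m - 1) Lp, line_jet e (m - 1) Lm}"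
      using indep by blast
  qed
qed

end
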